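(* For each natural number $n\ge1$, $$SPT^{+}(n)=\frac{5}{72}M_4(n)-\frac{1}{6}n^2p(n)+\frac{1}{36}np(n)-\eta_4(n).$$
   Context: Notation: $(X)_\infty=(X;q)_\infty:=\prod_{k\ge0}(1-Xq^k)$. The function $SPT^{+}$: for each $j\ge1$ define sequences $spt_j'(n)$ and $spt_j^{*}(n)$ ($n\ge1$) by $$\sum_{n\ge1}spt_j'(n)q^n:=\frac{q^{j}}{(1-q^{j})^2(q^{j+1})_{\infty}},\qquad \sum_{n\ge1}spt_j^{*}(n)q^n:=\sum_{m\ge1}\left(q^{m}+2q^{2m}+3q^{3m}+\cdots\right)\frac{1}{(1-q^{m+1})(1-q^{m+2})\cdots(1-q^{m+j})},$$ where $q^{m}+2q^{2m}+3q^{3m}+\cdots=q^m/(1-q^m)^2$. Let $spt_j^{+}(n):=\sum_{k\le n}spt_j^{*}(k)\,spt_j'(n-k)$ (with $spt_j^{*}(0)=spt_j'(0)=0$), i.e. the coefficient of $q^n$ in the product of the two series, and let $SPT^{+}(n):=\sum_{j\ge1}spt_j^{+}(n)$ (a finite sum for each $n$). $p(n)$ is the number of partitions of $n$. Crank moments: $M_k(n):=\sum_{m\in\mathbb{Z}}m^kM(m,n)$, where $M(m,n)$ is the number of partitions of $n$ with crank $m$. The crank of a partition is its largest part if it has no part equal to $1$; otherwise, if $\omega\geq 1$ is the number of parts equal to $1$ and $\mu$ is the number of parts larger than $\omega$, the crank is $\mu-\omega$. For $n=1$ the usual convention is $M(-1,1)=M(1,1)=1$, $M(0,1)=-1$, and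 $M(m,1)=0$ otherwise; thus $\sum_{n\ge0}\sum_{m}M(m,n)z^mq^n=\frac{(q)_\infty}{(zq)_\infty(z^{-1}q)_\infty}$. Symmetrized rank function: let $N(m,n)$ be the number of partitions of $n$ with rank $m$, where the rank is the largest part minus the number of parts. Then $$\eta_k(n):=\sum_{j=-n}^{n}\binom{j+\lfloor\frac{k-1}{2}\rfloor}{k}N(j,n),$$ with $\binom{x}{k}=x(x-1)\cdots(x-k+1)/k!$ for any integer $x$. In particular $\eta_4(n)=\sum_{j=-n}^{n}\binom{j+1}{4}N(j,n)$. The generating function is $\sum_{n\ge0}\eta_{2k}(n)q^n=\frac{1}{(q)_{\infty}}\sum_{n\in\mathbb{Z},\,n\neq0}\frac{(-1)^{n+1}q^{n(3n+1)/2+kn}}{(1-q^n)^{2k}}$ for $k\ge1$. *)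

theory Defs
  imports "HOL-Analysis.Analysis"
begin

text \<open>
  The variable \<open>q\<close> of all generating functions is \<^term>\<open>fps_X :: real fps\<close>.  Infinite sums and products
  of series are taken in the coefficientwise topology of \<^typ>\<open>real fps\<close>.
\<close>

definition qpoch_inf :: "real fps \<Rightarrow> real fps" where
  "qpoch_inf x = (\<Prod>k. 1 - x * fps_X ^ k)"

definition spt_prime :: "nat \<Rightarrow> nat \<Rightarrow> real" where
  "spt_prime j n =
     fps_nth (fps_X ^ j / ((1 - fps_X ^ j) ^ 2 * qpoch_inf (fps_X ^ (j + 1)))) n"

text \<open>The series \<open>q\<^sup>m + 2 q\<^sup>2\<^sup>m + 3 q\<^sup>3\<^sup>m + \<dots>\<close>.\<close>

definition multiples_fps :: "nat \<Rightarrow> real fps" where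
  "multiples_fps m = (\<Sum>k. of_nat (Suc k) * fps_X ^ (Suc k * m))"

definition spt_star :: "nat \<Rightarrow> nat \<Rightarrow> real" where
  "spt_star j n =
     fps_nth (\<Sum>i. let m = Suc i in multiples_fps m * (1 / (\<Prod>r=1..j. 1 - fps_X ^ (m + r)))) n"

text \<open>
  For \<open>j \<ge> 1\<close> the constant coefficients of both generating functions vanish, so
  \<^term>\<open>spt_star j 0\<close> and \<^term>\<open>spt_prime j 0\<close> are \<open>0\<close> below.
\<close>

definition spt_plus :: "nat \<Rightarrow> nat \<Rightarrow> real" where
  "spt_plus j n = (\<Sum>k\<le>n. spt_star j k * spt_prime j (n - k))"

text \<open>Only the terms with \<open>j \<le> n\<close> are nonzero.\<close>

definition SPT_plus :: "nat \<Rightarrow> real" where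
  "SPT_plus n = (\<Sum>\<^sub>\<infinity>j\<in>{1..}. spt_plus j n)"

definition partitions :: "nat \<Rightarrow> nat multiset set" where
  "partitions n = {P. 0 \<notin># P \<and> \<Sum>\<^sub># P = n}"

definition partition_count :: "nat \<Rightarrow> nat" where
  "partition_count n = card (partitions n)"

text \<open>The inserted \<open>0\<close> only serves to give the empty partition largest part \<open>0\<close>.\<close>

definition largest_part :: "nat multiset \<Rightarrow> nat" where
  "largest_part P = Max (insert 0 (set_mset P))"

definition rank_part :: "nat multiset \<Rightarrow> int" where
  "rank_part P = int (largest_part P) - int (size P)"

definition rank_count :: "int \<Rightarrow> nat \<Rightarrow> nat" where
  "rank_count m n = card {P \<in> partitions n. rank_part P = m}"

definition crank :: "nat multiset \<Rightarrow> int" where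
  "crank P =
     (let \<omega> = count P 1 in
      if \<omega> = 0 then int (largest_part P)
      else int (size {#x \<in># P. x > \<omega>#}) - int \<omega>)"

text \<open>
  For \<open>n = 1\<close> the values are those of the coefficients of
  \<open>(q)\<^sub>\<infinity> / ((z q)\<^sub>\<infinity> (z\<^sup>-\<^sup>1 q)\<^sub>\<infinity>)\<close>, not the combinatorial count.
\<close>

definition crank_count :: "int \<Rightarrow> nat \<Rightarrow> int" where
  "crank_count m n =
     (if n = 1 then (if m = 1 \<or> m = - 1 then 1 else if m = 0 then - 1 else 0)
      else int (card {P \<in> partitions n. crank P = m}))"

text \<open>Only finitely many \<open>m\<close> contribute, so the infinite sum is a finite one.\<close>

definition crank_moment :: "nat \<Rightarrow> nat \<Rightarrow> real" where
  "crank_moment k n = (\<Sum>\<^sub>\<infinity>m::int\<in>UNIV. of_int (m ^ k * crank_count m n))"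

definition sym_rank_moment :: "nat \<Rightarrow> nat \<Rightarrow> real" where
  "sym_rank_moment k n =
     (\<Sum>j = - int n..int n.
        (of_int (j + (int k - 1) div 2) gchoose k) * real (rank_count j n))"

text \<open>The infinite products and sums in the definitions above converge.\<close>

lemma fps_sums_if_vanishing:
  fixes f :: "nat \<Rightarrow> real fps"
  assumes "\<And>i n. n \<le> i \<Longrightarrow> fps_nth (f i) n = 0"
  shows "f sums Abs_fps (\<lambda>n. \<Sum>i<n. fps_nth (f i) n)"
  unfolding sums_def
proof (rule tendsto_fpsI)
  fix n
  have "fps_nth (\<Sum>i<N. f i) n = (\<Sum>i<n. fps_nth (f i) n)" if "N \<ge> n" for N
    unfolding fps_sum_nth using that assms by (intro sum.mono_neutral_right) auto
  then show "\<forall>\<^sub>F N in sequentially. fps_nth (\<Sum>i<N. f i) n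
      = fps_nth (Abs_fps (\<lambda>n. \<Sum>i<n. fps_nth (f i) n)) n"
    unfolding eventually_sequentially by auto
qed

lemma multiples_fps_sums:
  assumes "m \<ge> 1"
  shows "(\<lambda>k. of_nat (Suc k) * fps_X ^ (Suc k * m)) sums multiples_fps m"
    and "n < m \<Longrightarrow> fps_nth (multiples_fps m) n = 0"
proof -
  let ?f = "\<lambda>k. of_nat (Suc k) * fps_X ^ (Suc k * m) :: real fps"
  have le: "Suc k \<le> Suc k * m" and le': "m \<le> Suc k * m" for k
    using assms by (cases m; simp)+
  have nth: "fps_nth (?f k) i = 0" if "i < Suc k * m" for i k
    using that fps_X_power_mult_right_nth[of "of_nat (Suc k) :: real fps" "Suc k * m" i]
    by simp
  have "fps_nth (?f k) i = 0" if "i \<le> k" for i k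
    using that le[of k] by (intro nth) linarith
  from fps_sums_if_vanishing[of ?f, OF this]
  have *: "?f sums Abs_fps (\<lambda>n. \<Sum>i<n. fps_nth (?f i) n)" by blast
  then show "?f sums multiples_fps m"
    unfolding multiples_fps_def by (rule summable_sums[OF sums_summable])
  show "fps_nth (multiples_fps m) n = 0" if "n < m"
  proof -
    have "fps_nth (?f i) n = 0" for i
      using that le'[of i] by (intro nth) linarith
    then show ?thesis
      unfolding multiples_fps_def sums_unique[OF *, symmetric] by simp
  qed
qed

lemma qpoch_inf_convergent:
  assumes "j \<ge> 1"
  shows "convergent_prod (\<lambda>k. 1 - fps_X ^ j * fps_X ^ k :: real fps)"
proof -
  define P where "P = (\<lambda>N. \<Prod>k\<le>N. 1 - fps_X ^ j * fps_X ^ k :: real fps)"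
  have step: "fps_nth (P (Suc N)) n = fps_nth (P N) n" if "n \<le> N" for n N
  proof -
    have "P (Suc N) = P N - fps_X ^ (j + Suc N) * P N"
      by (simp add: P_def algebra_simps power_add)
    moreover have "fps_nth (fps_X ^ (j + Suc N) * P N) n = 0"
      unfolding fps_X_power_mult_nth using that by simp
    ultimately show ?thesis by (metis fps_sub_nth diff_zero)
  qed
  have stable: "fps_nth (P N) n = fps_nth (P n) n" if "n \<le> N" for n N
    using that by (induction N rule: dec_induct) (auto simp: step)
  have "P \<longlonglongrightarrow> Abs_fps (\<lambda>n. fps_nth (P n) n)"
  proof (rule tendsto_fpsI)
    fix n
    show "\<forall>\<^sub>F N in sequentially. fps_nth (P N) n = fps_nth (Abs_fps (\<lambda>n. fps_nth (P n) n)) n"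
      unfolding eventually_sequentially fps_nth_Abs_fps using stable by blast
  qed
  moreover have "fps_nth (P 0) 0 = 1"
    using assms by (simp add: P_def)
  then have "Abs_fps (\<lambda>n. fps_nth (P n) n) \<noteq> 0"
    by (metis fps_nth_Abs_fps fps_zero_nth zero_neq_one)
  ultimately have "raw_has_prod (\<lambda>k. 1 - fps_X ^ j * fps_X ^ k) 0 (Abs_fps (\<lambda>n. fps_nth (P n) n))"
    by (simp add: raw_has_prod_def P_def)
  then show ?thesis by (auto simp: convergent_prod_def)
qed

lemma spt_star_summable:
  "summable (\<lambda>i. let m = Suc i in
     multiples_fps m * (1 / (\<Prod>r=1..j. 1 - fps_X ^ (m + r))))"
proof -
  have "fps_nth (let m = Suc i in
     multiples_fps m * (1 / (\<Prod>r=1..j. 1 - fps_X ^ (m + r)))) n = 0" if "n \<le> i" for i n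
    using that unfolding Let_def fps_mult_nth
    by (intro sum.neutral) (auto simp: multiples_fps_sums)
  from fps_sums_if_vanishing[of "\<lambda>i. let m = Suc i in
     multiples_fps m * (1 / (\<Prod>r=1..j. 1 - fps_X ^ (m + r)))", OF this]
  show ?thesis by (auto simp: summable_def)
qed

end

theory Submission
  imports Defs
begin

text \<open>
  Write \<open>(q)\<^sub>n\<close> for \<open>(1 - q)(1 - q\<^sup>2) \<dots> (1 - q\<^sup>n)\<close>, put \<open>a\<^sub>k = q\<^sup>k / (1 - q\<^sup>k)\<^sup>2\<close> and
  \<open>P = 1 / (q)\<^sub>\<infinity>\<close>, and let \<open>e\<^sub>1 = \<Sum> a\<^sub>k\<close> and \<open>h\<^sub>2 = \<Sum> a\<^sub>i a\<^sub>j\<close> over \<open>i \<le> j\<close>.  The identity holds because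
  each of its terms is the coefficient of \<open>q\<^sup>n\<close> in \<open>P\<close> times an expression in sums of
  this kind.

  The series of \<open>SPT\<^sup>+\<close> is \<open>P \<Sum> a\<^sub>j a\<^sub>m (q)\<^sub>j (q)\<^sub>m / (q)\<^sub>j\<^sub>+\<^sub>m\<close> over \<open>j, m \<ge> 1\<close>.  The sum over \<open>m\<close> can be
  evaluated: with \<open>A\<^sub>j = \<Sum> a\<^sub>m (q)\<^sub>m / (q)\<^sub>m\<^sub>+\<^sub>j\<close> a telescoping argument gives
  \<open>(q)\<^sub>j\<^sub>-\<^sub>1 A\<^sub>j\<^sub>-\<^sub>1 - (q)\<^sub>j A\<^sub>j = a\<^sub>j (1 - (q)\<^sub>j)\<close>, so the series equals \<open>P (e\<^sub>1\<^sup>2 - h\<^sub>2 + S)\<close>, where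
  \<open>S = \<Sum> a\<^sub>i a\<^sub>j (q)\<^sub>i\<close> over \<open>i \<le> j\<close> (lemma \<open>SPT_plus_eq\<close>).

  For the rank, a case of Heine's transformation (lemma \<open>heine_transformation\<close>) says that the
  two-variable series of partitions, with \<open>x\<close> marking the number of parts and \<open>y\<close> the largest part,
  becomes \<open>\<Sum> (x)\<^sub>n (y)\<^sub>n q\<^sup>n / (q)\<^sub>n\<close> after multiplication by \<open>(xq)\<^sub>\<infinity> (yq)\<^sub>\<infinity> / (q)\<^sub>\<infinity>\<close>.  For the crank, the
  q-binomial theorem yields the product \<open>(q)\<^sub>\<infinity> / ((xq)\<^sub>\<infinity> (yq)\<^sub>\<infinity>)\<close> with \<open>xy = 1\<close> (lemma
  \<open>crank_gf_product\<close>).  If \<open>xy = 1\<close> and \<open>t = (1 - x)(1 - y)\<close>, then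
  \<open>(1 - xq\<^sup>k)(1 - yq\<^sup>k) = (1 - q\<^sup>k)\<^sup>2 (1 + t a\<^sub>k)\<close>, so both series are power series in \<open>t\<close>.  Substituting
  \<open>x = 1 + u\<close> gives \<open>t = - u\<^sup>2 / x\<close>, and the moments in question are coefficients of \<open>u\<close>: the
  coefficient of \<open>t\<^sup>2\<close> in the rank series is the series \<open>P (h\<^sub>2 - S)\<close> of \<open>\<eta>\<^sub>4\<close>, and the crank series gives
  \<open>P (24 h\<^sub>2 + 2 e\<^sub>1)\<close> as the series of \<open>M\<^sub>4\<close>.

  The sum of the \<open>SPT\<^sup>+\<close> series and the \<open>\<eta>\<^sub>4\<close> series is therefore \<open>P e\<^sub>1\<^sup>2\<close>.  That the remaining terms also add up
  to \<open>P e\<^sub>1\<^sup>2\<close> is Ramanujan's formula for the derivative of the Eisenstein series of weight two,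
  here in the form \<open>2 e\<^sub>1\<^sup>2 = 5 \<Sum> a\<^sub>k\<^sup>2 + e\<^sub>1 - q de\<^sub>1/dq\<close> (lemma \<open>ramanujan_identity\<close>), together with
  \<open>q dP/dq = P e\<^sub>1\<close>.

  Only the coefficients of \<open>q\<^sup>0, \<dots>, q\<^sup>n\<close> matter for the claim at \<open>n\<close>, so all infinite sums and products
  are replaced by finite ones and identities by congruences modulo \<open>q\<^sup>n\<^sup>+\<^sup>1\<close>.
\<close>

section \<open>Congruences between power series\<close>

text \<open>
  Congruence modulo the ideal generated by \<open>u\<close> and \<open>v\<close>.  Two generators are needed since the
  expansions in \<open>t\<close> are truncated modulo \<open>t\<^sup>3\<close> as well as modulo a power of \<open>q\<close>.
\<close>

definition cong2 :: "'a::comm_ring_1 \<Rightarrow> 'a \<Rightarrow> 'a \<Rightarrow> 'a \<Rightarrow> bool" where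
  "cong2 u v f g \<longleftrightarrow> (\<exists>a b. f - g = u * a + v * b)"

abbreviation qcong :: "nat \<Rightarrow> 'a::comm_ring_1 fps \<Rightarrow> 'a fps \<Rightarrow> bool" where
  "qcong N \<equiv> cong2 (fps_X ^ Suc N) 0"

lemma cong2_refl [simp, intro]: "cong2 u v f f"
  unfolding cong2_def by (rule exI[of _ 0])+ simp

lemma cong2_sym:
  assumes "cong2 u v f g"
  shows "cong2 u v g f"
proof -
  obtain a b where "f - g = u * a + v * b" using assms unfolding cong2_def by blast
  then have "g - f = u * (- a) + v * (- b)" by (simp add: algebra_simps)
  then show ?thesis unfolding cong2_def by blast
qed

lemma cong2_add:
  assumes "cong2 u v f g" "cong2 u v f' g'"
  shows "cong2 u v (f + f') (g + g')"
proof -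
  obtain a b where 1: "f - g = u * a + v * b" using assms unfolding cong2_def by blast
  obtain a' b' where 2: "f' - g' = u * a' + v * b'" using assms unfolding cong2_def by blast
  have "(f + f') - (g + g') = (f - g) + (f' - g')" by simp
  also have "\<dots> = u * (a + a') + v * (b + b')" unfolding 1 2 by (simp add: algebra_simps)
  finally show ?thesis unfolding cong2_def by blast
qed

lemma cong2_trans [trans]:
  assumes "cong2 u v f g" "cong2 u v g h"
  shows "cong2 u v f h"
proof -
  obtain a b where 1: "f - g = u * a + v * b" using assms unfolding cong2_def by blast
  obtain a' b' where 2: "g - h = u * a' + v * b'" using assms unfolding cong2_def by blast
  have "f - h = (f - g) + (g - h)" by simp
  also have "\<dots> = u * (a + a') + v * (b + b')" unfolding 1 2 by (simp add: algebra_simps)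
  finally show ?thesis unfolding cong2_def by blast
qed

lemma cong2_mult:
  assumes "cong2 u v f g" "cong2 u v f' g'"
  shows "cong2 u v (f * f') (g * g')"
proof -
  obtain a b where 1: "f - g = u * a + v * b" using assms unfolding cong2_def by blast
  obtain a' b' where 2: "f' - g' = u * a' + v * b'" using assms unfolding cong2_def by blast
  have "f * f' - g * g' = (f - g) * f' + g * (f' - g')" by (simp add: algebra_simps)
  also have "\<dots> = u * (a * f' + g * a') + v * (b * f' + g * b')"
    unfolding 1 2 by (simp add: algebra_simps)
  finally show ?thesis unfolding cong2_def by blast
qed

lemma cong2_uminus: "cong2 u v f g \<Longrightarrow> cong2 u v (- f) (- g)"
  using cong2_mult[of u v "-1" "-1" f g] by simp

lemma cong2_diff:
  "cong2 u v f g \<Longrightarrow> cong2 u v f' g' \<Longrightarrow> cong2 u v (f - f') (g - g')"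
  using cong2_add[of u v f g "- f'" "- g'"] cong2_uminus[of u v f' g'] by simp

lemma cong2_power: "cong2 u v f g \<Longrightarrow> cong2 u v (f ^ n) (g ^ n)"
  by (induction n) (auto intro: cong2_mult)

lemma cong2_sum:
  "(\<And>i. i \<in> A \<Longrightarrow> cong2 u v (f i) (g i)) \<Longrightarrow> cong2 u v (sum f A) (sum g A)"
  by (induction A rule: infinite_finite_induct) (auto intro: cong2_add)

lemma cong2_prod:
  "(\<And>i. i \<in> A \<Longrightarrow> cong2 u v (f i) (g i)) \<Longrightarrow> cong2 u v (prod f A) (prod g A)"
  by (induction A rule: infinite_finite_induct) (auto intro: cong2_mult)

lemmas cong2_intros = cong2_add cong2_diff cong2_mult cong2_power cong2_sum cong2_prod cong2_refl

lemma cong2_weaken: "cong2 u 0 f g \<Longrightarrow> cong2 u v f g"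
  unfolding cong2_def by (metis mult_zero_left mult_zero_right)

lemma cong2_cancel_unit:
  assumes "cong2 u v (h * f) (h * g)" "h' * h = 1"
  shows "cong2 u v f g"
proof -
  have "cong2 u v (h' * (h * f)) (h' * (h * g))" by (intro cong2_intros assms(1))
  then show ?thesis using assms(2) by (simp add: mult.assoc[symmetric])
qed

lemma qcong_iff: "qcong N f g \<longleftrightarrow> (\<forall>n\<le>N. fps_nth f n = fps_nth g n)"
proof
  assume "qcong N f g"
  then obtain a where a: "f - g = fps_X ^ Suc N * a" unfolding cong2_def by auto
  show "\<forall>n\<le>N. fps_nth f n = fps_nth g n"
  proof (intro allI impI)
    fix n assume "n \<le> N"
    then have "fps_nth (f - g) n = 0" unfolding a fps_X_power_mult_nth by simp
    then show "fps_nth f n = fps_nth g n" by simp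
  qed
next
  assume *: "\<forall>n\<le>N. fps_nth f n = fps_nth g n"
  have "f - g = fps_X ^ Suc N * fps_shift (Suc N) (f - g)"
    by (rule fps_ext) (use * in \<open>auto simp: fps_X_power_mult_nth simp del: power_Suc\<close>)
  then show "qcong N f g" unfolding cong2_def by (metis add.right_neutral mult_zero_left)
qed

lemma qcongD: "qcong N f g \<Longrightarrow> n \<le> N \<Longrightarrow> fps_nth f n = fps_nth g n"
  unfolding qcong_iff by blast

lemma qcong_X_power_0: "N < m \<Longrightarrow> qcong N (fps_X ^ m * f) 0"
  unfolding qcong_iff fps_X_power_mult_nth by simp

section \<open>Two transformations of q-series\<close>

text \<open>
  All q-shifted factorials are cases of this product: \<open>{..<n}\<close> gives \<open>(x)\<^sub>n\<close>, \<open>{1..n}\<close> gives \<open>(xq)\<^sub>n\<close>,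
  and \<open>{m<..n}\<close> gives the quotient of \<open>(xq)\<^sub>n\<close> by \<open>(xq)\<^sub>m\<close> without a division.
\<close>

definition qprod :: "nat set \<Rightarrow> 'a::comm_ring_1 fps \<Rightarrow> 'a fps" where
  "qprod A x = (\<Prod>k\<in>A. 1 - x * fps_X ^ k)"

lemma qprod_empty [simp]: "qprod {} x = 1"
  by (simp add: qprod_def)

lemma qprod_Suc:
  "qprod {..<Suc n} x = qprod {..<n} x * (1 - x * fps_X ^ n)"
  "qprod {1..Suc n} x = qprod {1..n} x * (1 - x * fps_X ^ Suc n)"
  by (simp_all add: qprod_def mult.commute)

lemma qprod_tail_Suc:
  "m \<le> n \<Longrightarrow> qprod {m<..Suc n} x = qprod {m<..n} x * (1 - x * fps_X ^ Suc n)"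
proof -
  assume "m \<le> n"
  then have "{m<..Suc n} = insert (Suc n) {m<..n}" by auto
  then show ?thesis by (simp add: qprod_def mult.commute)
qed

lemma qprod_image_Suc: "qprod A (x * fps_X) = qprod (Suc ` A) x"
  unfolding qprod_def by (subst prod.reindex) (auto simp: mult.assoc)

lemma qprod_pull_first: "qprod {..<Suc n} x = (1 - x) * qprod {1..n} x"
proof -
  have "{..<Suc n} = insert 0 {1..n}" by auto
  then show ?thesis by (simp add: qprod_def)
qed

lemma qprod_shift_lessThan: "qprod {..<n} (x * fps_X) = qprod {1..n} x"
  unfolding qprod_image_Suc by (simp add: image_Suc_lessThan)

lemma qprod_Un:
  "finite A \<Longrightarrow> finite B \<Longrightarrow> A \<inter> B = {} \<Longrightarrow> qprod (A \<union> B) x = qprod A x * qprod B x"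
  unfolding qprod_def by (rule prod.union_disjoint)

lemma qprod_split: "n \<le> N \<Longrightarrow> qprod {1..N} x = qprod {1..n} x * qprod {n<..N} x"
  by (subst qprod_Un[symmetric]) (auto intro!: arg_cong[of _ _ "\<lambda>A. qprod A x"])

lemma qprod_1_0 [simp]: "qprod {..<Suc n} 1 = 0"
  by (subst qprod_pull_first) simp

lemma qprod_zero [simp]: "qprod A 0 = 1"
  by (simp add: qprod_def)

lemma qprod_cong2: "cong2 u v x x' \<Longrightarrow> cong2 u v (qprod A x) (qprod A x')"
  unfolding qprod_def by (intro cong2_intros)

lemma qprod_nth_0: "0 \<notin> A \<Longrightarrow> fps_nth (qprod A x) 0 = 1"
  unfolding qprod_def
  by (induction A rule: infinite_finite_induct) auto

text \<open>
  Factors with an exponent above \<open>N\<close> are congruent to \<open>1\<close>.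
\<close>

lemma qprod_truncate:
  assumes "finite A"
  shows "qcong N (qprod A x) (qprod (A \<inter> {..N}) x)"
proof -
  have "A = (A \<inter> {..N}) \<union> (A - {..N})" by auto
  then have "qprod A x = qprod (A \<inter> {..N}) x * qprod (A - {..N}) x"
    using qprod_Un[of "A \<inter> {..N}" "A - {..N}" x] assms by auto
  also have "qcong N \<dots> (qprod (A \<inter> {..N}) x * (\<Prod>k\<in>A - {..N}. 1 - 0))"
    unfolding qprod_def[of "A - _"]
    by (intro cong2_intros) (metis DiffD2 atMost_iff mult.commute not_le qcong_X_power_0)
  finally show ?thesis by simp
qed

text \<open>
  The series \<open>\<Sum> (x)\<^sub>n (y)\<^sub>n q\<^sup>n / (q)\<^sub>n\<close> multiplied by \<open>(q)\<^sub>N\<close>, which clears the denominators.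
\<close>

definition heine_sum :: "nat \<Rightarrow> 'a::comm_ring_1 fps \<Rightarrow> 'a fps \<Rightarrow> 'a fps" where
  "heine_sum N x y =
     (\<Sum>n\<le>N. qprod {..<n} x * qprod {..<n} y * fps_X ^ n * qprod {n<..N} 1)"

text \<open>
  The series \<open>1 + \<Sum> x y\<^sup>n q\<^sup>n / (xq)\<^sub>n\<close> multiplied by \<open>(xq)\<^sub>N\<close>; its terms collect the partitions with
  largest part \<open>n\<close>, and \<open>x\<close> marks the number of parts.
\<close>

definition rank_sum :: "nat \<Rightarrow> 'a::comm_ring_1 fps \<Rightarrow> 'a fps \<Rightarrow> 'a fps" where
  "rank_sum N x y =
     qprod {1..N} x + (\<Sum>n=1..N. x * y ^ n * fps_X ^ n * qprod {n<..N} x)"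

lemma sum_qprod_tail_Suc:
  "(\<Sum>n\<in>A. f n * qprod {n<..Suc N} x) = (\<Sum>n\<in>A. f n * qprod {n<..N} x) * (1 - x * fps_X ^ Suc N)"
  if "A \<subseteq> {..N}"
  unfolding sum_distrib_right
  by (intro sum.cong refl) (use that in \<open>auto simp: qprod_tail_Suc mult.assoc simp del: power_Suc\<close>)

lemma heine_sum_Suc:
  "heine_sum (Suc N) x y =
     heine_sum N x y * (1 - fps_X ^ Suc N) + qprod {..<Suc N} x * qprod {..<Suc N} y * fps_X ^ Suc N"
  unfolding heine_sum_def sum.atMost_Suc
  by (subst sum_qprod_tail_Suc) (simp_all del: power_Suc)

lemma rank_sum_Suc:
  "rank_sum (Suc N) x y =
     rank_sum N x y * (1 - x * fps_X ^ Suc N) + x * y ^ Suc N * fps_X ^ Suc N"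
proof -
  have "(\<Sum>n=1..Suc N. x * y ^ n * fps_X ^ n * qprod {n<..Suc N} x) =
     (\<Sum>n=1..N. x * y ^ n * fps_X ^ n * qprod {n<..Suc N} x) + x * y ^ Suc N * fps_X ^ Suc N"
    by (simp del: power_Suc)
  also have "(\<Sum>n=1..N. x * y ^ n * fps_X ^ n * qprod {n<..Suc N} x) =
     (\<Sum>n=1..N. x * y ^ n * fps_X ^ n * qprod {n<..N} x) * (1 - x * fps_X ^ Suc N)"
    by (rule sum_qprod_tail_Suc) auto
  finally show ?thesis
    unfolding rank_sum_def qprod_Suc by (simp add: algebra_simps del: power_Suc)
qed

text \<open>
  After multiplication of \<open>rank_sum\<close> by \<open>(yq)\<^sub>N\<close>, the two sides of Heine's transformation satisfy the
  same first-order equation under \<open>x \<mapsto> xq\<close>.  For this side the difference telescopes, because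
  \<open>(1 - yq\<^sup>n)(1 - xq\<^sup>n) - (1 - q\<^sup>n) = q\<^sup>n (1 - x - y (1 - xq\<^sup>n))\<close>.
\<close>

lemma heine_sum_shift:
  "heine_sum N x y - y * heine_sum N (x * fps_X) y = qprod {..<Suc N} y * qprod {1..N} x"
proof (induction N)
  case 0
  show ?case by (simp add: heine_sum_def qprod_def)
next
  case (Suc N)
  define z where "z = (fps_X :: 'a fps) ^ Suc N"
  define A where "A = qprod {..<Suc N} y"
  define B where "B = qprod {1..N} x"
  define g where "g = heine_sum N x y"
  define g' where "g' = heine_sum N (x * fps_X) y"
  have IH: "g - y * g' = A * B" using Suc.IH unfolding g_def g'_def A_def B_def .
  have "heine_sum (Suc N) x y - y * heine_sum (Suc N) (x * fps_X) y =
     (g * (1 - z) + (1 - x) * B * A * z) - y * (g' * (1 - z) + B * (1 - x * z) * A * z)"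
    unfolding heine_sum_Suc qprod_shift_lessThan qprod_pull_first[of N x] qprod_Suc(2)
      z_def A_def B_def g_def g'_def ..
  also have "\<dots> = (g - y * g') * (1 - z) + A * B * z * (1 - x - y + x * y * z)"
    by (simp add: algebra_simps)
  also have "\<dots> = A * (1 - y * z) * (B * (1 - x * z))"
    unfolding IH by (simp add: algebra_simps)
  also have "\<dots> = qprod {..<Suc (Suc N)} y * qprod {1..Suc N} x"
    unfolding qprod_Suc(1)[of "Suc N" y] qprod_Suc(2)[of N x] A_def B_def z_def ..
  finally show ?case .
qed

lemma rank_sum_shift:
  "rank_sum (Suc N) x y = y * rank_sum N (x * fps_X) y + (1 - y) * qprod {1..Suc N} x"
proof (induction N)
  case 0
  show ?case by (simp add: rank_sum_def qprod_def algebra_simps)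
next
  case (Suc N)
  define z where "z = (fps_X :: 'a fps) ^ Suc (Suc N)"
  define B where "B = qprod {1..Suc N} x"
  define h where "h = rank_sum N (x * fps_X) y"
  define Y where "Y = y ^ Suc N"
  have s: "rank_sum (Suc N) (x * fps_X) y = h * (1 - x * z) + x * Y * z"
    unfolding rank_sum_Suc h_def z_def Y_def by (simp add: algebra_simps)
  have "rank_sum (Suc (Suc N)) x y =
      (y * h + (1 - y) * B) * (1 - x * z) + x * (y * Y) * z"
    unfolding rank_sum_Suc[of "Suc N"] Suc.IH
    unfolding h_def z_def B_def Y_def by simp
  also have "\<dots> = y * (h * (1 - x * z) + x * Y * z) + (1 - y) * (B * (1 - x * z))"
    by (simp add: algebra_simps)
  also have "B * (1 - x * z) = qprod {1..Suc (Suc N)} x"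
    unfolding qprod_Suc(2)[of "Suc N" x] B_def z_def ..
  finally show ?case unfolding s[symmetric] .
qed

lemma heine_sum_0: "heine_sum N 0 y = qprod {1..N} y"
proof (induction N)
  case 0
  then show ?case by (simp add: heine_sum_def)
next
  case (Suc N)
  then show ?case
    unfolding heine_sum_Suc qprod_pull_first qprod_Suc by (simp add: algebra_simps)
qed

lemma rank_sum_0: "rank_sum N 0 y = 1"
  by (simp add: rank_sum_def)

lemma rank_sum_Suc_qcong: "qcong N (rank_sum (Suc N) x y) (rank_sum N x y)"
proof -
  have "rank_sum (Suc N) x y = rank_sum N x y
      + fps_X ^ Suc N * (x * y ^ Suc N - x * rank_sum N x y)"
    unfolding rank_sum_Suc by (simp add: algebra_simps)
  also have "qcong N \<dots> (rank_sum N x y + 0)"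
    by (intro cong2_intros qcong_X_power_0) simp
  finally show ?thesis by simp
qed

text \<open>
  By the two shift equations the difference \<open>D\<close> of the two sides satisfies \<open>D(x) = y D(xq)\<close>.  Iterating
  moves the argument into the ideal of \<open>q\<^sup>N\<^sup>+\<^sup>1\<close>, and \<open>D(0) = 0\<close>.  Each coefficient of \<open>q\<close> is a polynomial in
  \<open>x\<close> and \<open>y\<close>, so that \<open>y = 1/x\<close> can be substituted later.
\<close>

lemma heine_transformation:
  "qcong N (qprod {1..N} y * rank_sum N x y) (heine_sum N x y)"
proof -
  define D where "D x = heine_sum N x y - qprod {1..N} y * rank_sum N x y" for x
  have step: "qcong N (D x) (y * D (x * fps_X))" for x
  proof -
    have "qcong N (D x) (heine_sum N x y - qprod {1..N} y * rank_sum (Suc N) x y)"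
      unfolding D_def by (intro cong2_intros cong2_sym[OF rank_sum_Suc_qcong])
    also have "\<dots> = y * D (x * fps_X) + qprod {1..N} y * (1 - y) * (qprod {1..N} x - qprod {1..Suc N} x)"
      using heine_sum_shift[of N x y]
      unfolding rank_sum_shift D_def qprod_pull_first by (simp add: algebra_simps)
    also have "\<dots> = y * D (x * fps_X) + fps_X ^ Suc N * (qprod {1..N} y * (1 - y) * (qprod {1..N} x * x))"
      unfolding qprod_Suc by (simp add: algebra_simps)
    also have "qcong N \<dots> (y * D (x * fps_X) + 0)"
      by (intro cong2_intros qcong_X_power_0) simp
    finally show ?thesis by simp
  qed
  have iter: "qcong N (D x) (y ^ m * D (x * fps_X ^ m))" for m
  proof (induction m)
    case 0
    then show ?case by simp
  next
    case (Suc m)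
    note Suc.IH
    also have "qcong N (y ^ m * D (x * fps_X ^ m)) (y ^ m * (y * D (x * fps_X ^ m * fps_X)))"
      by (intro cong2_intros step)
    also have "\<dots> = y ^ Suc m * D (x * fps_X ^ Suc m)" by (simp add: algebra_simps)
    finally show ?case .
  qed
  have D_cong: "qcong N (D z) (D 0)" if "qcong N z 0" for z
    unfolding D_def heine_sum_def rank_sum_def
    by (intro cong2_intros qprod_cong2 that)
  have "qcong N (D x) (y ^ Suc N * D (x * fps_X ^ Suc N))" by (rule iter)
  also have "qcong N \<dots> (y ^ Suc N * D 0)"
    by (intro cong2_intros D_cong) (metis mult.commute qcong_X_power_0 lessI)
  also have "D 0 = 0" by (simp add: D_def heine_sum_0 rank_sum_0)
  finally have "qcong N (heine_sum N x y - D x) (heine_sum N x y - 0)"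
    by (intro cong2_intros) simp
  then show ?thesis by (simp add: D_def)
qed

text \<open>
  The series \<open>\<Sum> (a)\<^sub>j z\<^sup>j / (q)\<^sub>j\<close> multiplied by \<open>(q)\<^sub>N\<close>.
\<close>

definition qbinom_sum :: "nat \<Rightarrow> 'a::comm_ring_1 fps \<Rightarrow> 'a fps \<Rightarrow> 'a fps" where
  "qbinom_sum N a z = (\<Sum>j\<le>N. qprod {..<j} a * z ^ j * qprod {j<..N} 1)"

lemma qbinom_sum_Suc:
  "qbinom_sum (Suc N) a z = qbinom_sum N a z * (1 - fps_X ^ Suc N) + qprod {..<Suc N} a * z ^ Suc N"
  unfolding qbinom_sum_def sum.atMost_Suc
  by (subst sum_qprod_tail_Suc) (simp_all del: power_Suc)

lemma qbinom_sum_shift: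
  "(1 - z) * qbinom_sum N a z =
     (1 - a * z) * qbinom_sum N a (z * fps_X) - qprod {..<Suc N} a * z ^ Suc N"
proof (induction N)
  case 0
  show ?case by (simp add: qbinom_sum_def qprod_def algebra_simps)
next
  case (Suc N)
  define w where "w = (fps_X :: 'a fps) ^ Suc N"
  define A where "A = qprod {..<Suc N} a"
  define Z where "Z = z ^ Suc N"
  define f where "f = qbinom_sum N a z"
  define f' where "f' = qbinom_sum N a (z * fps_X)"
  have IH: "(1 - z) * f = (1 - a * z) * f' - A * Z"
    using Suc.IH unfolding f_def f'_def A_def Z_def .
  have "(1 - z) * qbinom_sum (Suc N) a z = (1 - z) * f * (1 - w) + (1 - z) * A * Z"
    unfolding qbinom_sum_Suc f_def w_def A_def Z_def by (simp add: algebra_simps)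
  also have "\<dots> = (1 - a * z) * (f' * (1 - w) + A * (Z * w)) - A * (1 - a * w) * (z * Z)"
    unfolding IH by (simp add: algebra_simps)
  also have "f' * (1 - w) + A * (Z * w) = qbinom_sum (Suc N) a (z * fps_X)"
    unfolding qbinom_sum_Suc f'_def w_def A_def Z_def power_mult_distrib ..
  also have "A * (1 - a * w) = qprod {..<Suc (Suc N)} a"
    unfolding qprod_Suc(1)[of "Suc N"] A_def w_def ..
  finally show ?case by (simp add: Z_def)
qed

text \<open>
  Iterate \<open>(1 - z) f(z) = (1 - az) f(zq)\<close>, starting from \<open>z = yq\<close>, until the argument of \<open>f\<close> vanishes
  modulo \<open>q\<^sup>N\<^sup>+\<^sup>1\<close>.
\<close>

lemma qbinomial_theorem:
  "qcong N (qprod {1..N} y * qbinom_sum N a (y * fps_X)) (qprod {1..N} (a * y) * qprod {1..N} 1)"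
proof -
  let ?f = "qbinom_sum N a"
  have step: "qcong N ((1 - y * fps_X ^ Suc m) * ?f (y * fps_X ^ Suc m))
       ((1 - a * y * fps_X ^ Suc m) * ?f (y * fps_X ^ Suc (Suc m)))" for m
  proof -
    let ?z = "y * fps_X ^ Suc m"
    have "?z ^ Suc N = fps_X ^ (Suc m * Suc N) * y ^ Suc N"
      by (simp only: power_mult[symmetric] power_mult_distrib mult.commute)
    then have "(1 - ?z) * ?f ?z = (1 - a * ?z) * ?f (?z * fps_X)
        - qprod {..<Suc N} a * (fps_X ^ (Suc m * Suc N) * y ^ Suc N)"
      using qbinom_sum_shift[of ?z N a] by presburger
    also have "qcong N \<dots> ((1 - a * ?z) * ?f (?z * fps_X) - qprod {..<Suc N} a * 0)"
      by (intro cong2_intros qcong_X_power_0) auto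
    finally show ?thesis by (simp add: algebra_simps)
  qed
  have iter: "qcong N (qprod {1..m} y * ?f (y * fps_X)) (qprod {1..m} (a * y) * ?f (y * fps_X ^ Suc m))" for m
  proof (induction m)
    case 0
    then show ?case by simp
  next
    case (Suc m)
    have "qprod {1..Suc m} y * ?f (y * fps_X) = (1 - y * fps_X ^ Suc m) * (qprod {1..m} y * ?f (y * fps_X))"
      unfolding qprod_Suc by (simp only: ac_simps)
    also have "qcong N \<dots> ((1 - y * fps_X ^ Suc m) * (qprod {1..m} (a * y) * ?f (y * fps_X ^ Suc m)))"
      by (intro cong2_intros Suc.IH)
    also have "\<dots> = qprod {1..m} (a * y) * ((1 - y * fps_X ^ Suc m) * ?f (y * fps_X ^ Suc m))"
      by (simp only: ac_simps)
    also have "qcong N \<dots> (qprod {1..m} (a * y) * ((1 - a * y * fps_X ^ Suc m) * ?f (y * fps_X ^ Suc (Suc m))))"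
      by (intro cong2_intros step)
    finally show ?case unfolding qprod_Suc by (simp only: ac_simps)
  qed
  have "qcong N (?f (y * fps_X ^ Suc N)) (?f 0)"
    unfolding qbinom_sum_def
    by (intro cong2_intros) (metis mult.commute qcong_X_power_0 lessI)
  moreover have "?f 0 = qprod {1..N} 1"
  proof -
    have "?f 0 = (\<Sum>j\<in>{0}. qprod {..<j} a * 0 ^ j * qprod {j<..N} 1)"
      unfolding qbinom_sum_def
      by (rule sum.mono_neutral_right) (auto simp: power_0_left split: if_splits)
    also have "\<dots> = qprod {0<..N} 1" by simp
    also have "{0<..N} = {1..N}" by auto
    finally show ?thesis .
  qed
  ultimately have "qcong N (qprod {1..N} (a * y) * ?f (y * fps_X ^ Suc N)) (qprod {1..N} (a * y) * qprod {1..N} 1)"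
    by (intro cong2_intros) simp
  with iter[of N] show ?thesis by (rule cong2_trans)
qed

section \<open>Partitions counted by size and largest part\<close>

definition partitions_in :: "nat set \<Rightarrow> nat \<Rightarrow> nat multiset set" where
  "partitions_in S n = {P \<in> partitions n. set_mset P \<subseteq> S}"

text \<open>
  Partitions into parts from \<open>S\<close>, a part \<open>p\<close> contributing the factor \<open>w p\<close>.  Part-dependent weights
  are needed for the crank, where only the parts larger than the number of ones are marked.
\<close>

definition parts_gf :: "(nat \<Rightarrow> 'a::comm_ring_1) \<Rightarrow> nat set \<Rightarrow> 'a fps" where
  "parts_gf w S = Abs_fps (\<lambda>n. \<Sum>P\<in>partitions_in S n. \<Prod>p\<in>#P. w p)"

lemma partition_part_le: "P \<in> partitions n \<Longrightarrow> p \<in># P \<Longrightarrow> 1 \<le> p \<and> p \<le> n"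
  unfolding partitions_def
  by (auto dest: multi_member_split simp: Suc_le_eq intro: gr0I)

lemma partition_size_le: "P \<in> partitions n \<Longrightarrow> size P \<le> n"
proof -
  have "0 \<notin># P \<Longrightarrow> size P \<le> sum_mset P" for P :: "nat multiset"
    by (induction P) auto
  then show "P \<in> partitions n \<Longrightarrow> size P \<le> n" by (auto simp: partitions_def)
qed

lemma finite_partitions [simp]: "finite (partitions n)"
proof -
  have "partitions n \<subseteq> mset ` {xs. set xs \<subseteq> {1..n} \<and> length xs \<le> n}"
  proof
    fix P assume P: "P \<in> partitions n"
    obtain xs where xs: "mset xs = P" by (metis ex_mset)
    then have "set xs \<subseteq> {1..n}" "length xs \<le> n"
      using partition_part_le[OF P] partition_size_le[OF P] by auto
    then show "P \<in> mset ` {xs. set xs \<subseteq> {1..n} \<and> length xs \<le> n}" using xs by blast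
  qed
  then show ?thesis by (rule finite_subset) (intro finite_imageI finite_lists_length_le, simp)
qed

lemma finite_partitions_in [simp]: "finite (partitions_in S n)"
  by (simp add: partitions_in_def)

lemma partitions_in_all: "{1..n} \<subseteq> S \<Longrightarrow> partitions_in S n = partitions n"
  unfolding partitions_in_def using partition_part_le by fastforce

lemma partitions_0 [simp]: "partitions 0 = {{#}}"
  using partition_size_le[of _ 0] by (auto simp: partitions_def)

lemma partitions_in_insert:
  assumes "k \<ge> 1" "k \<notin> S"
  shows "partitions_in (insert k S) n =
     partitions_in S n \<union> (if k \<le> n then add_mset k ` partitions_in (insert k S) (n - k) else {})"
proof (intro equalityI subsetI)
  fix P assume P: "P \<in> partitions_in (insert k S) n"
  show "P \<in> partitions_in S n \<union> (if k \<le> n then add_mset k ` partitions_in (insert k S) (n - k) else {})"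
  proof (cases "k \<in># P")
    case True
    then obtain Q where Q: "P = add_mset k Q" by (metis multi_member_split)
    with P have "k \<le> n" "Q \<in> partitions_in (insert k S) (n - k)"
      by (auto simp: partitions_in_def partitions_def)
    with Q show ?thesis by auto
  next
    case False
    with P show ?thesis by (auto simp: partitions_in_def)
  qed
next
  fix P assume "P \<in> partitions_in S n \<union> (if k \<le> n then add_mset k ` partitions_in (insert k S) (n - k) else {})"
  then show "P \<in> partitions_in (insert k S) n"
    using assms by (auto simp: partitions_in_def partitions_def split: if_splits)
qed

text \<open>
  A partition either avoids the part \<open>k\<close> or arises from a smaller one by adding a copy of \<open>k\<close>.
\<close>

lemma parts_gf_insert:
  assumes "k \<ge> 1" "k \<notin> S"
  shows "parts_gf w (insert k S) * (1 - fps_const (w k) * fps_X ^ k) = parts_gf w S"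
proof (rule fps_ext)
  fix n
  let ?W = "\<lambda>P. \<Prod>p\<in>#P. w p"
  define R where "R = (if k \<le> n then add_mset k ` partitions_in (insert k S) (n - k) else {})"
  have "fps_nth (parts_gf w (insert k S)) n = sum ?W (partitions_in S n) + sum ?W R"
    unfolding parts_gf_def fps_nth_Abs_fps partitions_in_insert[OF assms, of n] R_def[symmetric]
    using assms by (intro sum.union_disjoint) (auto simp: R_def partitions_in_def)
  also have "sum ?W R = (if k \<le> n then w k * fps_nth (parts_gf w (insert k S)) (n - k) else 0)"
  proof -
    have "inj_on (add_mset k) A" for A :: "nat multiset set" by (auto intro: inj_onI)
    then show ?thesis unfolding R_def parts_gf_def by (simp add: sum.reindex sum_distrib_left)
  qed
  finally show "fps_nth (parts_gf w (insert k S) * (1 - fps_const (w k) * fps_X ^ k)) n = fps_nth (parts_gf w S) n"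
    by (simp add: right_diff_distrib mult.assoc[symmetric] fps_X_power_mult_right_nth mult.commute[of _ "fps_const _"])
       (simp add: parts_gf_def)
qed

lemma parts_gf_empty: "parts_gf w {} = 1"
proof (rule fps_ext)
  fix n
  have "partitions_in {} n = (if n = 0 then {{#}} else {})"
    by (auto simp: partitions_in_def partitions_def)
  then show "fps_nth (parts_gf w {}) n = fps_nth 1 n" by (simp add: parts_gf_def)
qed

lemma parts_gf_prod:
  assumes "finite S" "0 \<notin> S"
  shows "parts_gf w S * (\<Prod>k\<in>S. 1 - fps_const (w k) * fps_X ^ k) = 1"
  using assms
proof (induction S rule: finite_induct)
  case empty
  then show ?case by (simp add: parts_gf_empty)
next
  case (insert k S)
  have "parts_gf w (insert k S) * (\<Prod>k\<in>insert k S. 1 - fps_const (w k) * fps_X ^ k) =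
     (parts_gf w (insert k S) * (1 - fps_const (w k) * fps_X ^ k)) * (\<Prod>k\<in>S. 1 - fps_const (w k) * fps_X ^ k)"
    using insert by (simp add: mult.assoc)
  also have "\<dots> = 1"
    using insert by (subst parts_gf_insert) (auto simp: Suc_le_eq intro: gr0I)
  finally show ?case .
qed

lemma parts_gf_qprod:
  assumes "finite S" "0 \<notin> S"
  shows "parts_gf (\<lambda>_. c) S * qprod S (fps_const c) = 1"
  using parts_gf_prod[OF assms, of "\<lambda>_. c"] unfolding qprod_def .

lemma largest_part_ge: "p \<in># P \<Longrightarrow> p \<le> largest_part P"
  unfolding largest_part_def by auto

lemma largest_part_in: "P \<noteq> {#} \<Longrightarrow> 0 \<notin># P \<Longrightarrow> largest_part P \<in># P"
proof -
  assume P: "P \<noteq> {#}" "0 \<notin># P"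
  then obtain p where p: "p \<in># P" by blast
  have "largest_part P \<in> insert 0 (set_mset P)"
    unfolding largest_part_def by (rule Max_in) auto
  moreover have "largest_part P \<noteq> 0"
    using largest_part_ge[OF p] p P(2) by (metis le_zero_eq)
  ultimately show ?thesis by simp
qed

lemma largest_part_le: "(\<And>p. p \<in># P \<Longrightarrow> p \<le> l) \<Longrightarrow> largest_part P \<le> l"
  unfolding largest_part_def by auto

lemma partitions_by_largest_part:
  assumes "n \<ge> 1"
  shows "partitions n = (\<Union>l\<in>{1..n}. add_mset l ` partitions_in {1..l} (n - l))"
proof (intro equalityI subsetI)
  fix P assume P: "P \<in> partitions n"
  define l where "l = largest_part P"
  have l: "l \<in># P" unfolding l_def
    using P assms by (intro largest_part_in) (auto simp: partitions_def)
  then obtain Q where Q: "P = add_mset l Q" by (metis multi_member_split)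
  have "Q \<in> partitions_in {1..l} (n - l)"
  proof -
    have "Q \<in> partitions (n - l)" using P Q by (auto simp: partitions_def)
    moreover have "set_mset Q \<subseteq> {1..l}"
    proof
      fix p assume "p \<in># Q"
      then have "p \<in># P" using Q by simp
      then show "p \<in> {1..l}"
        using partition_part_le[OF P, of p] largest_part_ge[of p P] by (simp add: l_def)
    qed
    ultimately show ?thesis by (simp add: partitions_in_def)
  qed
  with Q partition_part_le[OF P l]
  show "P \<in> (\<Union>l\<in>{1..n}. add_mset l ` partitions_in {1..l} (n - l))" by auto
next
  fix P assume "P \<in> (\<Union>l\<in>{1..n}. add_mset l ` partitions_in {1..l} (n - l))"
  then show "P \<in> partitions n" by (auto simp: partitions_in_def partitions_def)
qed

lemma largest_part_add_mset: "Q \<in> partitions_in {1..l} m \<Longrightarrow> largest_part (add_mset l Q) = l"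
  by (intro antisym largest_part_le largest_part_ge) (auto simp: partitions_in_def)

definition joint_gf :: "'a::comm_ring_1 \<Rightarrow> 'a \<Rightarrow> 'a fps" where
  "joint_gf x y = Abs_fps (\<lambda>n. \<Sum>P\<in>partitions n. x ^ size P * y ^ largest_part P)"

lemma joint_gf_0: "fps_nth (joint_gf x y) 0 = 1"
  by (simp add: joint_gf_def largest_part_def)

lemma joint_gf_nth:
  assumes "n \<ge> 1"
  shows "fps_nth (joint_gf x y) n =
     (\<Sum>l=1..n. x * y ^ l * fps_nth (parts_gf (\<lambda>_. x) {1..l}) (n - l))"
proof -
  have "fps_nth (joint_gf x y) n =
     (\<Sum>l=1..n. \<Sum>P\<in>add_mset l ` partitions_in {1..l} (n - l). x ^ size P * y ^ largest_part P)"
    unfolding joint_gf_def fps_nth_Abs_fps partitions_by_largest_part[OF assms]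
  proof (rule sum.UNION_disjoint)
    show "\<forall>i\<in>{1..n}. \<forall>j\<in>{1..n}. i \<noteq> j \<longrightarrow>
      add_mset i ` partitions_in {1..i} (n - i) \<inter> add_mset j ` partitions_in {1..j} (n - j) = {}"
    proof (intro ballI impI equals0I)
      fix i j P
      assume "i \<noteq> j" and "P \<in> add_mset i ` partitions_in {1..i} (n - i) \<inter> add_mset j ` partitions_in {1..j} (n - j)"
      then show False by (metis IntE imageE largest_part_add_mset)
    qed
  qed auto
  also have "\<dots> = (\<Sum>l=1..n. x * y ^ l * fps_nth (parts_gf (\<lambda>_. x) {1..l}) (n - l))"
  proof (intro sum.cong refl)
    fix l
    have "(\<Sum>P\<in>add_mset l ` partitions_in {1..l} (n - l). x ^ size P * y ^ largest_part P) =
      (\<Sum>Q\<in>partitions_in {1..l} (n - l). x * y ^ l * x ^ size Q)"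
      by (subst sum.reindex) (auto simp: largest_part_add_mset mult_ac intro!: sum.cong inj_onI)
    then show "(\<Sum>P\<in>add_mset l ` partitions_in {1..l} (n - l). x ^ size P * y ^ largest_part P) =
      x * y ^ l * fps_nth (parts_gf (\<lambda>_. x) {1..l}) (n - l)"
      by (simp add: parts_gf_def sum_distrib_left)
  qed
  finally show ?thesis .
qed

lemma joint_gf_qcong:
  "qcong N (joint_gf x y)
     (1 + (\<Sum>l=1..N. fps_const x * fps_const y ^ l * fps_X ^ l * parts_gf (\<lambda>_. x) {1..l}))"
  unfolding qcong_iff
proof (intro allI impI)
  fix n assume n: "n \<le> N"
  have t: "fps_nth (fps_const x * fps_const y ^ l * fps_X ^ l * F) n =
      (if l \<le> n then x * y ^ l * fps_nth F (n - l) else 0)" for l F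
    by (simp add: fps_const_power mult.assoc fps_X_power_mult_nth)
  show "fps_nth (joint_gf x y) n = fps_nth
     (1 + (\<Sum>l=1..N. fps_const x * fps_const y ^ l * fps_X ^ l * parts_gf (\<lambda>_. x) {1..l})) n"
  proof (cases "n = 0")
    case True
    then show ?thesis by (simp add: joint_gf_0 fps_sum_nth t)
  next
    case False
    then have "fps_nth (joint_gf x y) n =
       (\<Sum>l=1..n. x * y ^ l * fps_nth (parts_gf (\<lambda>_. x) {1..l}) (n - l))"
      by (intro joint_gf_nth) simp
    also have "\<dots> = (\<Sum>l=1..N. if l \<le> n then x * y ^ l * fps_nth (parts_gf (\<lambda>_. x) {1..l}) (n - l) else 0)"
      using n by (intro sum.mono_neutral_cong_left) auto
    finally show ?thesis using False unfolding fps_add_nth fps_sum_nth t by simp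
  qed
qed

lemma joint_gf_rank_sum:
  "qcong N (joint_gf x y * qprod {1..N} (fps_const x)) (rank_sum N (fps_const x) (fps_const y))"
proof -
  let ?x = "fps_const x" and ?y = "fps_const y"
  have "qcong N (joint_gf x y * qprod {1..N} ?x)
     ((1 + (\<Sum>l=1..N. ?x * ?y ^ l * fps_X ^ l * parts_gf (\<lambda>_. x) {1..l})) * qprod {1..N} ?x)"
    by (intro cong2_mult joint_gf_qcong cong2_refl)
  also have "\<dots> = rank_sum N ?x ?y"
    unfolding rank_sum_def distrib_right sum_distrib_right mult_1
  proof (intro arg_cong2[of _ _ _ _ "(+)"] sum.cong refl)
    fix l assume l: "l \<in> {1..N}"
    then have "qprod {1..N} ?x = qprod {1..l} ?x * qprod {l<..N} ?x" by (intro qprod_split) auto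
    then have "?x * ?y ^ l * fps_X ^ l * parts_gf (\<lambda>_. x) {1..l} * qprod {1..N} ?x =
      ?x * ?y ^ l * fps_X ^ l * (parts_gf (\<lambda>_. x) {1..l} * qprod {1..l} ?x) * qprod {l<..N} ?x"
      by (simp only: mult.assoc)
    then show "?x * ?y ^ l * fps_X ^ l * parts_gf (\<lambda>_. x) {1..l} * qprod {1..N} ?x =
      ?x * ?y ^ l * fps_X ^ l * qprod {l<..N} ?x"
      by (subst (asm) parts_gf_qprod) auto
  qed
  finally show ?thesis .
qed

text \<open>
  For \<open>y = 1/x\<close> the partition series on the left is the rank generating function.
\<close>

lemma joint_gf_heine:
  "qcong N (joint_gf x y * (qprod {1..N} (fps_const x) * qprod {1..N} (fps_const y)))
     (heine_sum N (fps_const x) (fps_const y))"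
proof -
  have "joint_gf x y * (qprod {1..N} (fps_const x) * qprod {1..N} (fps_const y))
      = qprod {1..N} (fps_const y) * (joint_gf x y * qprod {1..N} (fps_const x))"
    by (simp only: ac_simps)
  also have "qcong N \<dots> (qprod {1..N} (fps_const y) * rank_sum N (fps_const x) (fps_const y))"
    by (intro cong2_mult joint_gf_rank_sum cong2_refl)
  also have "qcong N \<dots> (heine_sum N (fps_const x) (fps_const y))" by (rule heine_transformation)
  finally show ?thesis .
qed

text \<open>
  The case \<open>x = 1\<close> of the previous lemma, where all terms of the Heine sum but the first vanish.  It is
  applied to the partitions without ones, whose crank is the largest part.
\<close>

lemma largest_part_gf: "qcong N (joint_gf 1 y * qprod {1..N} (fps_const y)) 1"
proof (rule cong2_cancel_unit)
  show "parts_gf (\<lambda>_. 1) {1..N} * qprod {1..N} 1 = 1"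
    using parts_gf_qprod[of "{1..N}" 1] by simp
  have "heine_sum N 1 (fps_const y) = (\<Sum>n\<in>{0}. qprod {..<n} 1 * qprod {..<n} (fps_const y) * fps_X ^ n * qprod {n<..N} 1)"
    unfolding heine_sum_def
  proof (rule sum.mono_neutral_right)
    show "\<forall>i\<in>{..N} - {0}. qprod {..<i} 1 * qprod {..<i} (fps_const y) * fps_X ^ i * qprod {i<..N} 1 = 0"
    proof
      fix i assume "i \<in> {..N} - {0}"
      then obtain k where "i = Suc k" by (cases i) auto
      then have "qprod {..<i} 1 = (0 :: 'a fps)" by (simp only: qprod_1_0)
      then show "qprod {..<i} 1 * qprod {..<i} (fps_const y) * fps_X ^ i * qprod {i<..N} 1 = 0"
        by (simp only: mult_zero_left)
    qed
  qed auto
  also have "\<dots> = qprod {0<..N} 1" by simp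
  also have "{0<..N} = {1..N}" by auto
  finally have "heine_sum N 1 (fps_const y) = qprod {1..N} 1" .
  then show "qcong N (qprod {1..N} 1 * (joint_gf 1 y * qprod {1..N} (fps_const y))) (qprod {1..N} 1 * 1)"
    using joint_gf_heine[of N 1 y] by (simp add: mult_ac del: power_Suc)
qed

section \<open>The product formula for the crank\<close>

text \<open>
  The power \<open>x\<^sup>m\<close> for an integer \<open>m\<close>, with \<open>y\<close> in the role of the inverse of \<open>x\<close>.
\<close>

definition signed_power :: "'a::comm_ring_1 \<Rightarrow> 'a \<Rightarrow> int \<Rightarrow> 'a" where
  "signed_power x y m = (if m \<ge> 0 then x ^ nat m else y ^ nat (- m))"

text \<open>
  The coefficient of \<open>q\<close> follows the convention for \<open>n = 1\<close>, which makes the product formula hold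
  there too.
\<close>

definition crank_gf :: "'a::comm_ring_1 \<Rightarrow> 'a \<Rightarrow> 'a fps" where
  "crank_gf x y = Abs_fps (\<lambda>n. if n = 1 then x + y - 1
                               else \<Sum>P\<in>partitions n. signed_power x y (crank P))"

lemma signed_power_diff:
  assumes "x * y = 1"
  shows "signed_power x y (int a - int b) = x ^ a * y ^ b"
proof -
  have one: "x ^ k * y ^ k = 1" for k using assms by (simp add: power_mult_distrib[symmetric])
  show ?thesis
  proof (cases "b \<le> a")
    case True
    then have "x ^ a * y ^ b = x ^ (a - b) * (x ^ b * y ^ b)"
      by (simp add: mult.assoc[symmetric] power_add[symmetric])
    with True show ?thesis by (simp add: signed_power_def one nat_diff_distrib')
  next
    case False
    then have "y ^ b = y ^ (b - a) * y ^ a" by (simp add: power_add[symmetric])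
    then have "x ^ a * y ^ b = y ^ (b - a) * (x ^ a * y ^ a)" by (simp only: ac_simps)
    with False show ?thesis by (simp add: signed_power_def one nat_diff_distrib')
  qed
qed

text \<open>
  Removing one part \<open>1\<close> does not change the largest part of a partition of \<open>n \<ge> 2\<close>.
\<close>

lemma sum_largest_part_no_ones:
  assumes "n \<ge> 2"
  shows "(\<Sum>P | P \<in> partitions n \<and> 1 \<notin># P. x ^ largest_part P) =
     fps_nth ((1 - fps_X) * joint_gf 1 x) n"
proof -
  obtain m where m: "n = Suc m" "m \<ge> 1" using assms by (cases n) auto
  let ?f = "\<lambda>P. x ^ largest_part P"
  have 1: "partitions n = {P \<in> partitions n. 1 \<notin># P} \<union> add_mset 1 ` partitions m" (is "_ = ?A \<union> ?B")
  proof (intro equalityI subsetI)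
    fix P assume P: "P \<in> partitions n"
    show "P \<in> ?A \<union> ?B"
    proof (cases "1 \<in># P")
      case True
      then obtain Q where "P = add_mset 1 Q" by (metis multi_member_split)
      with P m show ?thesis by (auto simp: partitions_def)
    qed (use P in simp)
  qed (use m in \<open>auto simp: partitions_def\<close>)
  have "sum ?f (partitions n) = sum ?f ?A + sum ?f ?B"
    by (subst 1, rule sum.union_disjoint) auto
  also have "sum ?f ?B = sum ?f (partitions m)"
  proof (subst sum.reindex)
    show "(\<Sum>P\<in>partitions m. (?f \<circ> add_mset 1) P) = sum ?f (partitions m)"
    proof (intro sum.cong refl)
      fix P assume P: "P \<in> partitions m"
      with m obtain p where p: "p \<in># P" by (cases "P = {#}") (auto simp: partitions_def)
      have "1 \<le> largest_part P"
        using partition_part_le[OF P p] largest_part_ge[OF p] by linarith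
      then have "largest_part (add_mset 1 P) = largest_part P"
        unfolding largest_part_def by (simp add: max_def insert_commute[of 0])
      then show "(?f \<circ> add_mset 1) P = ?f P" by simp
    qed
  qed (auto intro: inj_onI)
  finally have "sum ?f ?A = fps_nth (joint_gf 1 x) n - fps_nth (joint_gf 1 x) m"
    by (simp add: joint_gf_def)
  then show ?thesis using m by (simp add: left_diff_distrib)
qed

text \<open>
  Split off the \<open>j\<close> ones.  The remaining parts are at least \<open>2\<close>, and the crank counts those above
  \<open>j\<close>.
\<close>

lemma sum_crank_ones:
  assumes xy: "x * y = 1" and "1 \<le> j" "j \<le> n" "n \<le> N"
  shows "(\<Sum>P | P \<in> partitions n \<and> count P 1 = j. signed_power x y (crank P)) =
     y ^ j * fps_nth (parts_gf (\<lambda>p. if p > j then x else 1) {2..N}) (n - j)"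
proof -
  let ?h = "\<lambda>Q. replicate_mset j 1 + Q"
  have img: "{P. P \<in> partitions n \<and> count P 1 = j} = ?h ` partitions_in {2..N} (n - j)"
  proof (intro equalityI subsetI)
    fix P assume P: "P \<in> {P. P \<in> partitions n \<and> count P 1 = j}"
    define Q where "Q = filter_mset (\<lambda>p. p \<noteq> 1) P"
    have "filter_mset (\<lambda>p. p = 1) P = replicate_mset j 1"
      using P by (simp add: filter_eq_replicate_mset)
    then have PQ: "P = ?h Q"
      unfolding Q_def by (metis multiset_partition)
    have "set_mset Q \<subseteq> {2..N}"
    proof
      fix p assume "p \<in># Q"
      then have "p \<in># P" "p \<noteq> 1" by (auto simp: Q_def)
      with partition_part_le[of P n p] P assms show "p \<in> {2..N}" by auto
    qed
    moreover have "Q \<in> partitions (n - j)"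
      using P PQ by (auto simp: partitions_def sum_mset_replicate_mset)
    ultimately show "P \<in> ?h ` partitions_in {2..N} (n - j)"
      using PQ by (auto simp: partitions_in_def)
  next
    fix P assume "P \<in> ?h ` partitions_in {2..N} (n - j)"
    then obtain Q where Q: "P = ?h Q" "Q \<in> partitions (n - j)" "set_mset Q \<subseteq> {2..N}"
      by (auto simp: partitions_in_def)
    then have "count Q 1 = 0" by (auto simp: count_eq_zero_iff)
    with Q assms show "P \<in> {P. P \<in> partitions n \<and> count P 1 = j}"
      by (auto simp: partitions_def)
  qed
  have "signed_power x y (crank (?h Q)) = y ^ j * (\<Prod>p\<in>#Q. if p > j then x else 1)"
    if Q: "Q \<in> partitions_in {2..N} (n - j)" for Q
  proof -
    have "count Q 1 = 0" using Q by (auto simp: partitions_in_def count_eq_zero_iff)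
    then have "crank (?h Q) = int (size {#p \<in># Q. p > j#}) - int j"
      using assms by (simp add: crank_def Let_def)
    moreover have "(\<Prod>p\<in>#Q. if p > j then x else 1) = x ^ size {#p \<in># Q. p > j#}"
      by (induction Q) auto
    ultimately show ?thesis by (simp add: signed_power_diff[OF xy] mult.commute)
  qed
  then have "(\<Sum>Q\<in>partitions_in {2..N} (n - j). signed_power x y (crank (?h Q))) =
     y ^ j * fps_nth (parts_gf (\<lambda>p. if p > j then x else 1) {2..N}) (n - j)"
    unfolding parts_gf_def fps_nth_Abs_fps sum_distrib_left by (rule sum.cong[OF refl])
  moreover have "inj_on ?h (partitions_in {2..N} (n - j))" by (auto intro: inj_onI)
  ultimately show ?thesis unfolding img by (simp only: sum.reindex o_def)
qed

lemma crank_gf_qcong: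
  assumes xy: "x * y = 1"
  shows "qcong N (crank_gf x y) ((1 - fps_X) * joint_gf 1 x +
     (\<Sum>j=1..N. fps_const y ^ j * fps_X ^ j * parts_gf (\<lambda>p. if p > j then x else 1) {2..N}))"
  unfolding qcong_iff
proof (intro allI impI)
  fix n assume n: "n \<le> N"
  let ?G = "\<lambda>j. parts_gf (\<lambda>p. if p > j then x else 1) {2..N}"
  have t: "fps_nth (fps_const y ^ j * fps_X ^ j * F) n =
      (if j \<le> n then y ^ j * fps_nth F (n - j) else 0)" for j F
    by (simp add: fps_const_power mult.assoc fps_X_power_mult_nth)
  have "fps_nth (\<Sum>j=1..N. fps_const y ^ j * fps_X ^ j * ?G j) n =
      (\<Sum>j=1..n. y ^ j * fps_nth (?G j) (n - j))"
    unfolding fps_sum_nth t using n by (intro sum.mono_neutral_cong_right) auto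
  moreover have "fps_nth (crank_gf x y) n = fps_nth ((1 - fps_X) * joint_gf 1 x) n
      + (\<Sum>j=1..n. y ^ j * fps_nth (?G j) (n - j))"
  proof -
    consider "n = 0" | "n = 1" | "n \<ge> 2" by linarith
    then show ?thesis
    proof cases
      case 1
      then show ?thesis
        by (simp add: crank_gf_def joint_gf_0 left_diff_distrib crank_def signed_power_def largest_part_def)
    next
      case 2
      have empty: "partitions_in S 0 = {{#}}" for S by (auto simp: partitions_in_def)
      then have "fps_nth (?G 1) 0 = 1" by (simp only: parts_gf_def fps_nth_Abs_fps) simp
      moreover have "fps_nth (joint_gf 1 x) 1 = x"
        using joint_gf_nth[of 1 1 x] by (simp add: parts_gf_def empty)
      ultimately show ?thesis using 2
        by (simp add: crank_gf_def left_diff_distrib joint_gf_0)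
    next
      case 3
      have eq: "partitions n = {P \<in> partitions n. 1 \<notin># P} \<union>
          (\<Union>j\<in>{1..n}. {P. P \<in> partitions n \<and> count P 1 = j})"
      proof -
        have "count P 1 \<le> n" if "P \<in> partitions n" for P
          using partition_size_le[OF that] count_le_size[of P 1] by linarith
        then show ?thesis by (auto simp: Suc_le_eq count_greater_zero_iff not_in_iff)
      qed
      have "fps_nth (crank_gf x y) n = (\<Sum>P\<in>partitions n. signed_power x y (crank P))"
        using 3 by (simp add: crank_gf_def)
      also have "\<dots> = (\<Sum>P | P \<in> partitions n \<and> 1 \<notin># P. signed_power x y (crank P))
        + (\<Sum>P\<in>(\<Union>j\<in>{1..n}. {P. P \<in> partitions n \<and> count P 1 = j}). signed_power x y (crank P))"
        by (subst eq, rule sum.union_disjoint) (auto simp: not_in_iff)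
      also have "(\<Sum>P\<in>(\<Union>j\<in>{1..n}. {P. P \<in> partitions n \<and> count P 1 = j}). signed_power x y (crank P))
        = (\<Sum>j=1..n. \<Sum>P | P \<in> partitions n \<and> count P 1 = j. signed_power x y (crank P))"
        by (rule sum.UNION_disjoint) auto
      also have "\<dots> = (\<Sum>j=1..n. y ^ j * fps_nth (?G j) (n - j))"
        using n by (intro sum.cong refl sum_crank_ones[OF xy]) auto
      also have "(\<Sum>P | P \<in> partitions n \<and> 1 \<notin># P. signed_power x y (crank P)) =
         (\<Sum>P | P \<in> partitions n \<and> 1 \<notin># P. x ^ largest_part P)"
        by (intro sum.cong refl) (auto simp: crank_def Let_def not_in_iff signed_power_def)
      also have "\<dots> = fps_nth ((1 - fps_X) * joint_gf 1 x) n"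
        by (rule sum_largest_part_no_ones[OF 3])
      finally show ?thesis .
    qed
  qed
  ultimately show "fps_nth (crank_gf x y) n = fps_nth ((1 - fps_X) * joint_gf 1 x +
     (\<Sum>j=1..N. fps_const y ^ j * fps_X ^ j * ?G j)) n" by simp
qed

text \<open>
  Multiplied by \<open>(xq)\<^sub>\<infinity>\<close> and \<open>(q\<^sup>2)\<^sub>\<infinity>\<close>, the partitions with \<open>j\<close> ones contribute
  \<open>(xq)\<^sub>j (yq)\<^sup>j (q\<^sup>j\<^sup>+\<^sup>1)\<^sub>\<infinity>\<close>, also for \<open>j = 0\<close>.  The q-binomial theorem with \<open>a = xq\<close> and \<open>z = yq\<close> sums this;
  there \<open>az = q\<^sup>2\<close> because \<open>xy = 1\<close>.
\<close>

lemma crank_gf_product: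
  assumes xy: "x * y = 1" and N: "N \<ge> 1"
  shows "qcong N (crank_gf x y * (qprod {1..N} (fps_const x) * qprod {1..N} (fps_const y))) (qprod {1..N} 1)"
proof (rule cong2_cancel_unit)
  let ?x = "fps_const x" and ?y = "fps_const y"
  let ?G = "\<lambda>j. parts_gf (\<lambda>p. if p > j then x else 1) {2..N}"
  let ?U = "qprod {2..N} (1 :: 'a fps)"
  show "parts_gf (\<lambda>_. 1) {2..N} * ?U = 1"
    using parts_gf_qprod[of "{2..N}" 1] by simp
  have split: "{1..N} = insert 1 {2..N}" "{1..N} = {0<..N}" using N by auto
  have first: "(1 - fps_X) * ?U = qprod {0<..N} 1"
    unfolding split(2)[symmetric] unfolding split(1) by (simp add: qprod_def)
  have G: "?G j * qprod {1..N} ?x * ?U = qprod {1..j} ?x * qprod {j<..N} 1"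
    if j: "j \<in> {1..N}" for j
  proof -
    have eq: "{2..N} = {2..j} \<union> {j<..N}" using j by auto
    have U: "?U = qprod {2..j} 1 * qprod {j<..N} 1"
      unfolding eq by (rule qprod_Un) auto
    have "(\<Prod>k\<in>{2..N}. 1 - fps_const (if k > j then x else 1) * fps_X ^ k) =
        qprod {2..j} 1 * qprod {j<..N} ?x"
      unfolding eq qprod_def
      by (subst prod.union_disjoint) (auto intro!: arg_cong2[of _ _ _ _ "(*)"] prod.cong)
    then have one: "?G j * (qprod {2..j} 1 * qprod {j<..N} ?x) = 1"
      using parts_gf_prod[of "{2..N}" "\<lambda>p. if p > j then x else 1"] by simp
    have "qprod {1..N} ?x = qprod {1..j} ?x * qprod {j<..N} ?x"
      using j by (intro qprod_split) auto
    then have "?G j * qprod {1..N} ?x * ?U =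
       (?G j * (qprod {2..j} 1 * qprod {j<..N} ?x)) * (qprod {1..j} ?x * qprod {j<..N} 1)"
      unfolding U by (simp only: ac_simps)
    then show ?thesis unfolding one by simp
  qed
  have "?U * (crank_gf x y * (qprod {1..N} ?x * qprod {1..N} ?y)) =
     qprod {1..N} ?y * (crank_gf x y * (qprod {1..N} ?x * ?U))" by (simp only: ac_simps)
  also have "qcong N \<dots> (qprod {1..N} ?y * (((1 - fps_X) * joint_gf 1 x +
     (\<Sum>j=1..N. ?y ^ j * fps_X ^ j * ?G j)) * (qprod {1..N} ?x * ?U)))"
    by (intro cong2_mult cong2_refl crank_gf_qcong[OF xy])
  also have "\<dots> = qprod {1..N} ?y * ((1 - fps_X) * ?U * (joint_gf 1 x * qprod {1..N} ?x) +
     (\<Sum>j=1..N. ?y ^ j * fps_X ^ j * (?G j * qprod {1..N} ?x * ?U)))"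
    unfolding distrib_right sum_distrib_right by (simp only: ac_simps)
  also have "\<dots> = qprod {1..N} ?y * ((1 - fps_X) * ?U * (joint_gf 1 x * qprod {1..N} ?x) +
     (\<Sum>j=1..N. ?y ^ j * fps_X ^ j * (qprod {1..j} ?x * qprod {j<..N} 1)))"
    by (simp only: G cong: sum.cong)
  also have "qcong N \<dots> (qprod {1..N} ?y * ((1 - fps_X) * ?U * 1 +
     (\<Sum>j=1..N. ?y ^ j * fps_X ^ j * (qprod {1..j} ?x * qprod {j<..N} 1))))"
    by (intro cong2_mult cong2_add cong2_refl largest_part_gf)
  also have "(1 - fps_X) * ?U * 1 + (\<Sum>j=1..N. ?y ^ j * fps_X ^ j * (qprod {1..j} ?x * qprod {j<..N} 1))
      = qbinom_sum N (?x * fps_X) (?y * fps_X)"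
  proof -
    have "{..N} = insert 0 {1..N}" by auto
    then show ?thesis
      unfolding qbinom_sum_def qprod_shift_lessThan first
      by (simp add: power_mult_distrib mult_ac)
  qed
  also have "qcong N (qprod {1..N} ?y * qbinom_sum N (?x * fps_X) (?y * fps_X))
     (qprod {1..N} (?x * fps_X * ?y) * qprod {1..N} 1)"
    by (rule qbinomial_theorem)
  also have "?x * fps_X * ?y = 1 * fps_X"
  proof -
    have "?x * fps_X * ?y = (?x * ?y) * fps_X" by (simp only: ac_simps)
    also have "?x * ?y = 1" using xy by simp
    finally show ?thesis .
  qed
  also have "qprod {1..N} (1 * fps_X) = qprod {2..Suc N} (1 :: 'a fps)"
    unfolding qprod_image_Suc image_Suc_atLeastAtMost by (simp add: numeral_2_eq_2)
  also have "qcong N (qprod {2..Suc N} 1 * qprod {1..N} 1) (qprod ({2..Suc N} \<inter> {..N}) 1 * qprod {1..N} (1 :: 'a fps))"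
    by (intro cong2_mult cong2_refl qprod_truncate) simp
  also have "{2..Suc N} \<inter> {..N} = {2..N}" by auto
  finally show "qcong N (?U * (crank_gf x y * (qprod {1..N} ?x * qprod {1..N} ?y))) (?U * qprod {1..N} 1)" .
qed

section \<open>The series of the SPT function\<close>

text \<open>
  The finite product \<open>(q)\<^sub>n\<close>.
\<close>

definition euler :: "nat \<Rightarrow> real fps" where
  "euler n = qprod {1..n} 1"

text \<open>
  These series and their companions \<open>q\<^sup>k / (1 - q\<^sup>k)\<^sup>2\<close> below are related by the operator
  \<open>q d/dq\<close>, which takes \<open>lam k\<close> to \<open>k\<close> times \<open>dlam k\<close>.
\<close>

definition lam :: "nat \<Rightarrow> real fps" where
  "lam k = fps_X ^ k * inverse (1 - fps_X ^ k)"

definition dlam :: "nat \<Rightarrow> real fps" where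
  "dlam k = fps_X ^ k * inverse (1 - fps_X ^ k) ^ 2"

text \<open>
  The elementary symmetric function of degree one, and below the complete homogeneous one of
  degree two, in \<open>dlam 1, \<dots>, dlam N\<close>.
\<close>

definition e1 :: "nat \<Rightarrow> real fps" where
  "e1 N = (\<Sum>k=1..N. dlam k)"

definition h2 :: "nat \<Rightarrow> real fps" where
  "h2 N = (\<Sum>j=1..N. dlam j * (\<Sum>i=1..j. dlam i))"

text \<open>
  Divided by \<open>(q)\<^sub>\<infinity>\<close> this is Garvan's second-order spt series.
\<close>

definition spt2_sum :: "nat \<Rightarrow> real fps" where
  "spt2_sum N = (\<Sum>j=1..N. dlam j * (\<Sum>i=1..j. dlam i * euler i))"

lemma inverse_one_minus_X_power:
  assumes "k \<ge> 1"
  shows "(1 - fps_X ^ k) * inverse (1 - fps_X ^ k :: real fps) = 1"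
  by (rule inverse_mult_eq_1') (use assms in simp)

lemma euler_0 [simp]: "euler 0 = 1"
  by (simp add: euler_def)

lemma euler_Suc: "euler (Suc n) = euler n * (1 - fps_X ^ Suc n)"
  unfolding euler_def qprod_Suc by simp

lemma euler_inverse [simp]: "euler n * inverse (euler n) = 1" "inverse (euler n) * euler n = 1"
  by (auto simp: euler_def qprod_nth_0 intro!: inverse_mult_eq_1' inverse_mult_eq_1)

lemma inverse_euler_Suc: "inverse (euler n) = inverse (euler (Suc n)) * (1 - fps_X ^ Suc n)"
proof -
  have "inverse (euler n) = inverse (euler n) * (euler (Suc n) * inverse (euler (Suc n)))" by simp
  also have "\<dots> = (inverse (euler n) * euler n) * (inverse (euler (Suc n)) * (1 - fps_X ^ Suc n))"
    unfolding euler_Suc[of n] by (simp only: ac_simps)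
  finally show ?thesis by simp
qed

definition star_sum :: "nat \<Rightarrow> nat \<Rightarrow> real fps" where
  "star_sum N j = (\<Sum>m=1..N. dlam m * (euler m * inverse (euler (m + j))))"

lemma euler_ratio_qcong:
  "qcong N (euler j * (euler N * inverse (euler (N + j)))) (euler j)"
proof -
  have "qcong N (euler (N + j)) (qprod ({1..N + j} \<inter> {..N}) 1)"
    unfolding euler_def by (rule qprod_truncate) simp
  also have "{1..N + j} \<inter> {..N} = {1..N}" by auto
  finally have *: "qcong N (euler (N + j)) (euler N)" unfolding euler_def .
  have "qcong N (euler j * (euler N * inverse (euler (N + j))))
          (euler j * (euler (N + j) * inverse (euler (N + j))))"
    by (intro cong2_intros cong2_sym[OF *])
  then show ?thesis by simp
qed

text \<open>
  Since \<open>(1 - q\<^sup>m\<^sup>+\<^sup>j) - (1 - q\<^sup>m) = q\<^sup>m (1 - q\<^sup>j)\<close>, the terms are differences of consecutive quotients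
  \<open>(q)\<^sub>m / (q)\<^sub>m\<^sub>+\<^sub>j\<close> (with \<open>Suc j\<close> for \<open>j\<close>).
\<close>

lemma star_sum_telescope:
  "(1 - fps_X ^ Suc j) * (\<Sum>m=1..N. lam m * (euler m * inverse (euler (m + Suc j))))
     = inverse (euler (Suc j)) - euler N * inverse (euler (N + Suc j))"
proof (induction N)
  case 0
  then show ?case by simp
next
  case (Suc N)
  define z where "z = (fps_X :: real fps) ^ Suc N"
  define w where "w = (fps_X :: real fps) ^ Suc j"
  define J where "J = inverse (euler (Suc N + Suc j))"
  define i where "i = inverse (1 - z)"
  have i: "(1 - z) * i = 1"
    unfolding i_def z_def by (rule inverse_one_minus_X_power) simp
  have J: "inverse (euler (N + Suc j)) = J * (1 - z * w)"
    unfolding J_def z_def w_def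
    using inverse_euler_Suc[of "N + Suc j"] by (simp only: power_add[symmetric] add_Suc)
  have "(1 - w) * (lam (Suc N) * (euler (Suc N) * J)) = (1 - w) * z * euler N * J * ((1 - z) * i)"
    unfolding lam_def euler_Suc i_def z_def by (simp only: ac_simps)
  also have "\<dots> = (1 - w) * z * euler N * J" unfolding i by simp
  also have "\<dots> = euler N * (J * (1 - z * w)) - euler N * (1 - z) * J"
    by (simp add: algebra_simps)
  also have "\<dots> = euler N * inverse (euler (N + Suc j)) - euler (Suc N) * J"
    unfolding J euler_Suc z_def ..
  finally have "(1 - w) * (lam (Suc N) * (euler (Suc N) * J)) =
    euler N * inverse (euler (N + Suc j)) - euler (Suc N) * J" .
  with Suc.IH show ?case unfolding w_def J_def
    by (simp add: distrib_left)
qed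

text \<open>
  Write \<open>1 - q\<^sup>m\<^sup>+\<^sup>j\<close> as \<open>(1 - q\<^sup>j) + q\<^sup>j (1 - q\<^sup>m)\<close> in the terms for index \<open>j - 1\<close>: the first summand gives the sum for
  index \<open>j\<close>, and the second one the telescoping sum.
\<close>

lemma euler_star_sum_step:
  "qcong N (euler j * star_sum N j)
     (euler (Suc j) * star_sum N (Suc j) + dlam (Suc j) * (1 - euler (Suc j)))"
proof -
  define w where "w = (fps_X :: real fps) ^ Suc j"
  define i where "i = inverse (1 - w)"
  have i: "(1 - w) * i = 1"
    unfolding i_def w_def by (rule inverse_one_minus_X_power) simp
  define B where "B = (\<Sum>m=1..N. lam m * (euler m * inverse (euler (m + Suc j))))"
  have "star_sum N j = (\<Sum>m=1..N. dlam m * (euler m * inverse (euler (m + Suc j))) * (1 - w)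
           + w * (lam m * (euler m * inverse (euler (m + Suc j)))))"
    unfolding star_sum_def
  proof (intro sum.cong refl)
    fix m assume "m \<in> {1..N}"
    then have m: "(1 - fps_X ^ m) * inverse (1 - fps_X ^ m :: real fps) = 1"
      by (intro inverse_one_minus_X_power) auto
    have lam: "lam m = dlam m * (1 - fps_X ^ m)"
      unfolding lam_def dlam_def power2_eq_square using m by (simp add: ac_simps)
    have inv: "inverse (euler (m + j)) = inverse (euler (m + Suc j)) * (1 - fps_X ^ m * w)"
      using inverse_euler_Suc[of "m + j"] unfolding w_def
      by (simp only: power_add[symmetric] add_Suc_right)
    show "dlam m * (euler m * inverse (euler (m + j))) =
      dlam m * (euler m * inverse (euler (m + Suc j))) * (1 - w) +
      w * (lam m * (euler m * inverse (euler (m + Suc j))))"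
      unfolding lam inv by (simp add: algebra_simps)
  qed
  also have "\<dots> = star_sum N (Suc j) * (1 - w) + w * B"
    unfolding star_sum_def B_def by (simp add: sum.distrib sum_distrib_left sum_distrib_right)
  finally have star: "star_sum N j = star_sum N (Suc j) * (1 - w) + w * B" .
  have 1: "euler j * star_sum N j = euler (Suc j) * star_sum N (Suc j) + euler j * w * B"
    unfolding star euler_Suc w_def[symmetric] by (simp add: algebra_simps)
  have B: "(1 - w) * B = inverse (euler (Suc j)) - euler N * inverse (euler (N + Suc j))"
    unfolding B_def w_def using star_sum_telescope[of j N] by simp
  have "euler j * w * B = euler j * w * B * ((1 - w) * i) * ((1 - w) * i)"
    unfolding i by simp
  also have "\<dots> = w * i ^ 2 * (euler (Suc j) * ((1 - w) * B))"
    unfolding euler_Suc w_def[symmetric] by (simp add: power2_eq_square ac_simps)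
  also have "\<dots> = dlam (Suc j) * (1 - euler (Suc j) * (euler N * inverse (euler (N + Suc j))))"
  proof -
    have "euler (Suc j) * ((1 - w) * B) = 1 - euler (Suc j) * (euler N * inverse (euler (N + Suc j)))"
      unfolding B right_diff_distrib by (simp only: euler_inverse)
    then show ?thesis unfolding dlam_def i_def w_def by (simp only:)
  qed
  also have "qcong N \<dots> (dlam (Suc j) * (1 - euler (Suc j)))"
    by (intro cong2_intros euler_ratio_qcong)
  finally show ?thesis unfolding 1 by (intro cong2_add cong2_refl)
qed

lemma euler_star_sum:
  "qcong N (euler j * star_sum N j) (e1 N - (\<Sum>i=1..j. dlam i * (1 - euler i)))"
proof (induction j)
  case 0
  then show ?case by (simp add: star_sum_def e1_def)
next
  case (Suc j)
  let ?a = "dlam (Suc j) * (1 - euler (Suc j))"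
  have "euler (Suc j) * star_sum N (Suc j) = (euler (Suc j) * star_sum N (Suc j) + ?a) - ?a" by simp
  also have "qcong N \<dots> ((e1 N - (\<Sum>i=1..j. dlam i * (1 - euler i))) - ?a)"
    by (intro cong2_intros cong2_trans[OF cong2_sym[OF euler_star_sum_step] Suc.IH])
  finally show ?case by (simp add: algebra_simps)
qed

text \<open>
  Summing the recurrence over \<open>j\<close> separates the pairs \<open>i \<le> j\<close>: subtracting \<open>h2\<close> removes them with weight one
  from \<open>e1\<^sup>2\<close>, and \<open>spt2_sum\<close> puts them back with weight \<open>(q)\<^sub>i\<close>.
\<close>

lemma spt_double_sum:
  "qcong N (\<Sum>j=1..N. dlam j * (euler j * star_sum N j)) (e1 N ^ 2 - h2 N + spt2_sum N)"
proof -
  have "qcong N (\<Sum>j=1..N. dlam j * (euler j * star_sum N j))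
      (\<Sum>j=1..N. dlam j * (e1 N - (\<Sum>i=1..j. dlam i * (1 - euler i))))"
    by (intro cong2_intros euler_star_sum)
  also have "\<dots> = (\<Sum>j=1..N. dlam j * e1 N - dlam j * (\<Sum>i=1..j. dlam i) + dlam j * (\<Sum>i=1..j. dlam i * euler i))"
    by (intro sum.cong refl) (simp add: algebra_simps sum_subtractf)
  also have "\<dots> = e1 N ^ 2 - h2 N + spt2_sum N"
    unfolding h2_def spt2_sum_def power2_eq_square e1_def
    by (simp only: sum.distrib sum_subtractf sum_distrib_right)
  finally show ?thesis .
qed

lemma qcong_LIMSEQ:
  assumes "s \<longlonglongrightarrow> l" "\<And>M. M \<ge> K \<Longrightarrow> qcong N (s M) g"
  shows "qcong N l g"
  unfolding qcong_iff
proof (intro allI impI)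
  fix n assume n: "n \<le> N"
  have "\<forall>\<^sub>F M in sequentially. fps_nth (s M) n = fps_nth l n"
    using assms(1) unfolding tendsto_fps_iff by blast
  moreover have "\<forall>\<^sub>F M in sequentially. fps_nth (s M) n = fps_nth g n"
    using eventually_ge_at_top[of K] by eventually_elim (rule qcongD[OF assms(2) n])
  ultimately have "\<forall>\<^sub>F M::nat in sequentially. fps_nth l n = fps_nth g n"
    by eventually_elim simp
  then show "fps_nth l n = fps_nth g n" by simp
qed

lemma qpoch_inf_qcong: "qcong N (qpoch_inf (fps_X ^ Suc j)) (qprod {j<..N} 1)"
proof -
  let ?f = "\<lambda>k. 1 - fps_X ^ Suc j * fps_X ^ k :: real fps"
  define G where "G = Abs_fps (\<lambda>n. fps_nth (qprod {j<..n} (1::real fps)) n)"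
  have part: "(\<Prod>k\<le>M. ?f k) = qprod {j<..Suc (j + M)} 1" for M
    by (induction M) (simp_all add: qprod_tail_Suc power_add[symmetric] qprod_def ac_simps
        atLeastSucAtMost_greaterThanAtMost[symmetric])
  have trunc: "qcong n (qprod {j<..Suc (j + M)} 1) (qprod {j<..n} (1::real fps))" if "n \<le> M" for n M
  proof -
    have "qcong n (qprod {j<..Suc (j + M)} 1) (qprod ({j<..Suc (j + M)} \<inter> {..n}) (1::real fps))"
      by (rule qprod_truncate) simp
    also have "{j<..Suc (j + M)} \<inter> {..n} = {j<..n}" using that by auto
    finally show ?thesis .
  qed
  have lim: "(\<lambda>M. \<Prod>k\<le>M. ?f k) \<longlonglongrightarrow> G"
  proof (rule tendsto_fpsI)
    fix n
    have "fps_nth (\<Prod>k\<le>M. ?f k) n = fps_nth G n" if "n \<le> M" for M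
      unfolding part G_def fps_nth_Abs_fps by (rule qcongD[OF trunc[OF that] order.refl])
    then show "\<forall>\<^sub>F M in sequentially. fps_nth (\<Prod>k\<le>M. ?f k) n = fps_nth G n"
      unfolding eventually_sequentially by blast
  qed
  have "fps_nth G 0 = 1" by (simp add: G_def)
  then have "G \<noteq> 0" by (metis fps_zero_nth zero_neq_one)
  with lim have "?f has_prod G" by (auto simp: has_prod_def raw_has_prod_def)
  then have "qpoch_inf (fps_X ^ Suc j) = G" unfolding qpoch_inf_def by (metis has_prod_unique)
  moreover have "qcong N G (qprod {j<..N} 1)"
    by (rule qcong_LIMSEQ[OF lim]) (unfold part, rule trunc)
  ultimately show ?thesis by (simp only:)
qed

lemma multiples_fps_qcong:
  assumes "m \<ge> 1"
  shows "qcong N (multiples_fps m) (dlam m)"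
proof -
  define z where "z = (fps_X :: real fps) ^ m"
  define i where "i = inverse (1 - z)"
  have i: "(1 - z) * i = 1" unfolding i_def z_def by (rule inverse_one_minus_X_power[OF assms])
  have fin: "(\<Sum>k<M. of_nat (Suc k) * z ^ Suc k) * (1 - z) ^ 2
      = z + z ^ Suc M * (of_nat M * z - of_nat (Suc M))" for M
    by (induction M) (simp_all add: algebra_simps power2_eq_square)
  have "qcong N (\<Sum>k<M. of_nat (Suc k) * fps_X ^ (Suc k * m)) (dlam m)" if M: "N \<le> M" for M
  proof -
    have zM: "z ^ Suc M = fps_X ^ (m * Suc M)" unfolding z_def by (simp only: power_mult)
    have gt: "N < m * Suc M"
      using M mult_le_mono1[OF assms, of "Suc M"]
      by (metis less_Suc_eq_le mult_1 order_less_le_trans)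
    have "(\<Sum>k<M. of_nat (Suc k) * fps_X ^ (Suc k * m)) = (\<Sum>k<M. of_nat (Suc k) * z ^ Suc k)"
      unfolding z_def by (simp only: power_mult[symmetric] mult.commute)
    also have "\<dots> = (\<Sum>k<M. of_nat (Suc k) * z ^ Suc k) * ((1 - z) * i) ^ 2"
      unfolding i by simp
    also have "\<dots> = i ^ 2 * ((\<Sum>k<M. of_nat (Suc k) * z ^ Suc k) * (1 - z) ^ 2)"
      by (simp only: power_mult_distrib ac_simps)
    also have "\<dots> = i ^ 2 * (z + fps_X ^ (m * Suc M) * (of_nat M * z - of_nat (Suc M)))"
      unfolding fin zM ..
    also have "qcong N \<dots> (i ^ 2 * (z + 0))"
      by (intro cong2_intros qcong_X_power_0 gt)
    finally show ?thesis unfolding dlam_def i_def z_def by (simp add: mult.commute)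
  qed
  then show ?thesis
    by (rule qcong_LIMSEQ[OF multiples_fps_sums(1)[OF assms, unfolded sums_def]])
qed

lemma inverse_qcong:
  assumes "qcong N f g" "fps_nth f 0 \<noteq> (0::real)"
  shows "qcong N (inverse f) (inverse g)"
proof -
  have g: "fps_nth g 0 \<noteq> 0" using assms unfolding qcong_iff by auto
  have "inverse f = inverse f * (g * inverse g)" using g by (simp add: inverse_mult_eq_1')
  also have "qcong N \<dots> (inverse f * (f * inverse g))"
    by (intro cong2_intros cong2_sym[OF assms(1)])
  also have "\<dots> = (inverse f * f) * inverse g" by (simp only: mult.assoc)
  also have "\<dots> = inverse g" using assms(2) by (simp add: inverse_mult_eq_1)
  finally show ?thesis .
qed

lemma spt_prime_qcong:
  assumes "1 \<le> j" "j \<le> N" "n \<le> N"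
  shows "spt_prime j n = fps_nth (inverse (euler N) * (dlam j * euler j)) n"
proof -
  let ?Q = "qpoch_inf (fps_X ^ Suc j)" and ?R = "qprod {j<..N} 1 :: real fps"
  have Q: "qcong N ?Q ?R" by (rule qpoch_inf_qcong)
  have R0: "fps_nth ?R 0 = 1" by (rule qprod_nth_0) simp
  have Q0: "fps_nth ?Q 0 = 1" using Q R0 unfolding qcong_iff by auto
  have j0: "fps_nth ((1 - fps_X ^ j) ^ 2 :: real fps) 0 = 1" using assms(1)
    by (simp add: fps_nth_power_0 power_0_left)
  have "fps_X ^ j / ((1 - fps_X ^ j) ^ 2 * ?Q) = fps_X ^ j * inverse ((1 - fps_X ^ j) ^ 2 * ?Q)"
    using Q0 j0 by (intro fps_divide_unit) simp
  also have "\<dots> = dlam j * inverse ?Q"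
    unfolding dlam_def fps_inverse_mult fps_inverse_power by simp
  also have "qcong N \<dots> (dlam j * inverse ?R)"
    by (intro cong2_intros inverse_qcong Q) (use Q0 in simp)
  also have "inverse ?R = inverse (euler N) * euler j"
  proof -
    have "euler N = euler j * ?R" unfolding euler_def by (rule qprod_split[OF assms(2)])
    then have "inverse (euler N) * euler j = (inverse (euler j) * euler j) * inverse ?R"
      by (simp only: fps_inverse_mult ac_simps)
    then show ?thesis by simp
  qed
  finally have "qcong N (fps_X ^ j / ((1 - fps_X ^ j) ^ 2 * ?Q)) (inverse (euler N) * (dlam j * euler j))"
    by (simp only: ac_simps)
  from qcongD[OF this assms(3)] show ?thesis unfolding spt_prime_def by simp
qed

lemma spt_prime_eq_0: "j \<ge> 1 \<Longrightarrow> n < j \<Longrightarrow> spt_prime j n = 0"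
proof -
  assume j: "1 \<le> j" "n < j"
  then have "spt_prime j n = fps_nth (inverse (euler j) * (dlam j * euler j)) n"
    by (intro spt_prime_qcong) simp_all
  also have "inverse (euler j) * (dlam j * euler j) = (inverse (euler j) * euler j) * dlam j"
    by (simp only: ac_simps)
  finally show ?thesis using j by (simp add: dlam_def fps_X_power_mult_nth)
qed

lemma spt_star_qcong:
  assumes "n \<le> N"
  shows "spt_star j n = fps_nth (star_sum N j) n"
proof -
  let ?s = "\<lambda>i. let m = Suc i in multiples_fps m * (1 / (\<Prod>r=1..j. 1 - fps_X ^ (m + r)))"
  have summand: "qcong N (?s i) (dlam (Suc i) * (euler (Suc i) * inverse (euler (Suc i + j))))" for i
  proof -
    let ?P = "\<Prod>r=1..j. 1 - fps_X ^ (Suc i + r) :: real fps"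
    have "?P = qprod {Suc i<..Suc i + j} 1"
      unfolding qprod_def
      by (rule prod.reindex_bij_witness[of _ "\<lambda>k. k - Suc i" "\<lambda>r. Suc i + r"]) auto
    then have eq: "euler (Suc i + j) = euler (Suc i) * ?P" and P0: "fps_nth ?P 0 = 1"
      unfolding euler_def using qprod_split[of "Suc i" "Suc i + j" 1] by (auto intro: qprod_nth_0)
    have "1 / ?P = 1 * inverse ?P" by (rule fps_divide_unit) (use P0 in simp)
    also have "\<dots> = (euler (Suc i) * inverse (euler (Suc i))) * inverse ?P" by simp
    also have "\<dots> = euler (Suc i) * inverse (euler (Suc i + j))"
      unfolding eq fps_inverse_mult by (simp only: ac_simps)
    finally show ?thesis unfolding Let_def
      by (simp only:) (intro cong2_intros multiples_fps_qcong, simp)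
  qed
  have "qcong N (\<Sum>i<M. ?s i) (star_sum N j)" if M: "N \<le> M" for M
  proof -
    let ?t = "\<lambda>m. dlam m * (euler m * inverse (euler (m + j)))"
    have "qcong N (\<Sum>i<M. ?s i) (\<Sum>i<M. ?t (Suc i))" by (intro cong2_intros summand)
    also have "(\<Sum>i<M. ?t (Suc i)) = (\<Sum>m=1..M. ?t m)"
      by (rule sum.reindex_bij_witness[of _ "\<lambda>k. k - 1" Suc]) auto
    also have "\<dots> = star_sum N j + (\<Sum>m=Suc N..M. ?t m)"
      unfolding star_sum_def using M
      by (subst sum.union_disjoint[symmetric]) (auto intro!: sum.cong)
    also have "qcong N \<dots> (star_sum N j + (\<Sum>m=Suc N..M. 0))"
    proof (intro cong2_intros)
      fix m assume "m \<in> {Suc N..M}"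
      then have "qcong N (fps_X ^ m * (inverse (1 - fps_X ^ m) ^ 2 * (euler m * inverse (euler (m + j))))) 0"
        by (intro qcong_X_power_0) auto
      then show "qcong N (?t m) 0" unfolding dlam_def by (simp only: mult.assoc)
    qed
    finally show ?thesis by simp
  qed
  moreover have "(\<lambda>M. \<Sum>i<M. ?s i) \<longlonglongrightarrow> suminf ?s"
    using spt_star_summable by (rule summable_LIMSEQ)
  ultimately have "qcong N (suminf ?s) (star_sum N j)" by (rule qcong_LIMSEQ[rotated])
  from qcongD[OF this assms] show ?thesis unfolding spt_star_def .
qed

lemma SPT_plus_eq:
  "SPT_plus n = fps_nth (inverse (euler n) * (e1 n ^ 2 - h2 n + spt2_sum n)) n"
proof -
  have "SPT_plus n = infsum (\<lambda>j. spt_plus j n) {1..n}"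
    unfolding SPT_plus_def
    by (rule infsum_cong_neutral) (auto simp: spt_plus_def spt_prime_eq_0)
  also have "\<dots> = (\<Sum>j=1..n. spt_plus j n)" by simp
  also have "\<dots> = (\<Sum>j=1..n. fps_nth (star_sum n j * (inverse (euler n) * (dlam j * euler j))) n)"
  proof (intro sum.cong refl)
    fix j assume j: "j \<in> {1..n}"
    have "spt_plus j n = (\<Sum>k=0..n. fps_nth (star_sum n j) k
        * fps_nth (inverse (euler n) * (dlam j * euler j)) (n - k))"
      unfolding spt_plus_def atLeast0AtMost using j
      by (intro sum.cong refl) (simp add: spt_star_qcong spt_prime_qcong[of j n])
    then show "spt_plus j n = fps_nth (star_sum n j * (inverse (euler n) * (dlam j * euler j))) n"
      by (simp add: fps_mult_nth)
  qed
  also have "\<dots> = fps_nth (inverse (euler n) * (\<Sum>j=1..n. dlam j * (euler j * star_sum n j))) n"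
    unfolding sum_distrib_left fps_sum_nth by (simp only: ac_simps)
  also have "\<dots> = fps_nth (inverse (euler n) * (e1 n ^ 2 - h2 n + spt2_sum n)) n"
  proof -
    have "qcong n (inverse (euler n) * (\<Sum>j=1..n. dlam j * (euler j * star_sum n j)))
      (inverse (euler n) * (e1 n ^ 2 - h2 n + spt2_sum n))"
      by (intro cong2_mult spt_double_sum cong2_refl)
    then show ?thesis by (rule qcongD) simp
  qed
  finally show ?thesis .
qed

section \<open>The first two moments of the partition function\<close>

lemma parts_gf_euler: "parts_gf (\<lambda>_. 1) {1..N} = inverse (euler N)"
proof -
  have "parts_gf (\<lambda>_. 1) {1..N} * euler N = 1"
    unfolding euler_def using parts_gf_qprod[of "{1..N}" "1::real"] by simp
  then have "parts_gf (\<lambda>_. 1) {1..N} * (euler N * inverse (euler N)) = inverse (euler N)"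
    by (simp only: mult.assoc[symmetric] mult_1)
  then show ?thesis by simp
qed

lemma partition_count_eq:
  assumes "n \<le> N"
  shows "real (partition_count n) = fps_nth (inverse (euler N)) n"
proof -
  have "partitions_in {1..N} n = partitions n"
    using assms by (intro partitions_in_all) auto
  then show ?thesis
    by (simp add: parts_gf_euler[symmetric] parts_gf_def partition_count_def)
qed

text \<open>
  The operator \<open>q d/dq\<close>, which multiplies the coefficient of \<open>q\<^sup>n\<close> by \<open>n\<close>.
\<close>

definition q_deriv :: "real fps \<Rightarrow> real fps" where
  "q_deriv f = fps_X * fps_deriv f"

lemma q_deriv_nth: "fps_nth (q_deriv f) n = real n * fps_nth f n"
  by (cases n) (simp_all add: q_deriv_def)

lemma q_deriv_mult: "q_deriv (f * g) = q_deriv f * g + f * q_deriv g"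
  by (simp add: q_deriv_def algebra_simps)

lemma q_deriv_diff: "q_deriv (f - g) = q_deriv f - q_deriv g"
  by (simp add: q_deriv_def algebra_simps)

lemma q_deriv_X_power: "q_deriv (fps_X ^ k) = of_nat k * fps_X ^ k"
  by (rule fps_ext) (simp add: q_deriv_nth fps_of_nat[symmetric])

lemma q_deriv_1 [simp]: "q_deriv 1 = 0"
  by (simp add: q_deriv_def)

lemma q_deriv_sum: "q_deriv (sum f A) = (\<Sum>i\<in>A. q_deriv (f i))"
  by (simp add: q_deriv_def sum_distrib_left fps_deriv_sum)

lemma lam_mult: "k \<ge> 1 \<Longrightarrow> (1 - fps_X ^ k) * lam k = fps_X ^ k"
  using inverse_one_minus_X_power[of k] unfolding lam_def
  by (metis mult.left_commute mult.right_neutral)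

lemma one_plus_lam: "k \<ge> 1 \<Longrightarrow> 1 + lam k = inverse (1 - fps_X ^ k)"
proof -
  assume "k \<ge> 1"
  then have i: "(1 - fps_X ^ k) * inverse (1 - fps_X ^ k :: real fps) = 1"
    by (rule inverse_one_minus_X_power)
  have "1 + lam k = (1 - fps_X ^ k) * inverse (1 - fps_X ^ k) + lam k" unfolding i ..
  also have "\<dots> = inverse (1 - fps_X ^ k)" unfolding lam_def by (simp add: algebra_simps)
  finally show ?thesis .
qed

lemma dlam_eq: "k \<ge> 1 \<Longrightarrow> dlam k = lam k + lam k ^ 2"
proof -
  assume "k \<ge> 1"
  then have "dlam k = lam k * (1 + lam k)"
    unfolding one_plus_lam[OF \<open>k \<ge> 1\<close>] by (simp add: dlam_def lam_def power2_eq_square mult.assoc)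
  then show ?thesis by (simp add: algebra_simps power2_eq_square)
qed

lemma q_deriv_lam:
  assumes "k \<ge> 1"
  shows "q_deriv (lam k) = of_nat k * dlam k"
proof -
  define z where "z = (fps_X :: real fps) ^ k"
  define i where "i = inverse (1 - z)"
  have i: "(1 - z) * i = 1" unfolding i_def z_def by (rule inverse_one_minus_X_power[OF assms])
  have "q_deriv ((1 - z) * lam k) = of_nat k * z"
    using lam_mult[OF assms] unfolding z_def by (simp only: q_deriv_X_power)
  then have "(1 - z) * q_deriv (lam k) = of_nat k * z * (1 + lam k)"
    unfolding q_deriv_mult q_deriv_diff z_def q_deriv_X_power by (simp add: algebra_simps)
  also have "\<dots> = of_nat k * z * i" unfolding one_plus_lam[OF assms] i_def z_def ..
  finally have "i * ((1 - z) * q_deriv (lam k)) = i * (of_nat k * z * i)" by (simp only:)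
  also have "i * ((1 - z) * q_deriv (lam k)) = ((1 - z) * i) * q_deriv (lam k)"
    by (simp only: ac_simps)
  also have "i * (of_nat k * z * i) = of_nat k * dlam k"
    unfolding dlam_def i_def z_def power2_eq_square by (simp only: ac_simps)
  finally show ?thesis unfolding i by simp
qed

definition lam_sum :: "nat \<Rightarrow> real fps" where
  "lam_sum N = (\<Sum>k=1..N. of_nat k * lam k)"

lemma q_deriv_euler: "q_deriv (euler N) = - (euler N * lam_sum N)"
proof (induction N)
  case 0
  then show ?case by (simp add: lam_sum_def)
next
  case (Suc N)
  define z where "z = (fps_X :: real fps) ^ Suc N"
  have z: "(1 - z) * lam (Suc N) = z" unfolding z_def by (rule lam_mult) simp
  have "q_deriv (euler (Suc N)) = - (euler N * lam_sum N) * (1 - z) - euler N * (of_nat (Suc N) * z)"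
    unfolding euler_Suc q_deriv_mult Suc.IH q_deriv_diff q_deriv_X_power z_def by simp
  also have "\<dots> = - (euler N * (1 - z) * lam_sum N) - euler N * (of_nat (Suc N) * ((1 - z) * lam (Suc N)))"
    unfolding z by (simp only: ac_simps mult_minus_left mult_minus_right)
  also have "\<dots> = - (euler (Suc N) * lam_sum (Suc N))"
    unfolding euler_Suc z_def[symmetric] lam_sum_def by (simp add: algebra_simps)
  finally show ?case .
qed

lemma q_deriv_partition_gf:
  "q_deriv (inverse (euler N)) = inverse (euler N) * lam_sum N"
proof -
  let ?P = "inverse (euler N)"
  have "0 = q_deriv (?P * euler N)" by simp
  also have "\<dots> = q_deriv ?P * euler N - (?P * euler N) * lam_sum N"
    unfolding q_deriv_mult q_deriv_euler by (simp add: mult.assoc)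
  finally have "q_deriv ?P * euler N = lam_sum N" by simp
  then have "q_deriv ?P * (euler N * ?P) = ?P * lam_sum N"
    by (metis mult.assoc mult.commute)
  then show ?thesis by simp
qed

lemma q_deriv_lam_sum: "q_deriv (lam_sum N) = (\<Sum>k=1..N. of_nat k ^ 2 * dlam k)"
proof -
  have "q_deriv (of_nat k * f) = of_nat k * q_deriv f" for k f
    by (rule fps_ext) (simp add: q_deriv_nth fps_of_nat[symmetric])
  then show ?thesis unfolding lam_sum_def q_deriv_sum
    by (intro sum.cong refl) (simp add: q_deriv_lam power2_eq_square mult.assoc)
qed

lemma partition_count_moments:
  assumes "n \<le> N"
  shows "real n * real (partition_count n) = fps_nth (inverse (euler N) * lam_sum N) n"
    and "real n ^ 2 * real (partition_count n) =
      fps_nth (inverse (euler N) * (lam_sum N ^ 2 + (\<Sum>k=1..N. of_nat k ^ 2 * dlam k))) n"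
proof -
  show 1: "real n * real (partition_count n) = fps_nth (inverse (euler N) * lam_sum N) n"
    unfolding partition_count_eq[OF assms] q_deriv_partition_gf[symmetric] q_deriv_nth ..
  have "real n ^ 2 * real (partition_count n) = fps_nth (q_deriv (inverse (euler N) * lam_sum N)) n"
    unfolding q_deriv_nth 1[symmetric] by (simp add: power2_eq_square)
  also have "q_deriv (inverse (euler N) * lam_sum N) =
      inverse (euler N) * (lam_sum N ^ 2 + (\<Sum>k=1..N. of_nat k ^ 2 * dlam k))"
    unfolding q_deriv_mult q_deriv_partition_gf q_deriv_lam_sum
    by (simp add: algebra_simps power2_eq_square)
  finally show "real n ^ 2 * real (partition_count n) =
      fps_nth (inverse (euler N) * (lam_sum N ^ 2 + (\<Sum>k=1..N. of_nat k ^ 2 * dlam k))) n" .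
qed

section \<open>A formula of Ramanujan\<close>

lemma geometric_sums:
  fixes z :: "'a::comm_ring_1"
  shows "(\<Sum>r=1..N. z ^ r) * (1 - z) = z + z ^ Suc N * (- 1)"
    and "(\<Sum>r=1..N. of_nat r * z ^ r) * (1 - z) ^ 2 = z + z ^ Suc N * (of_nat N * z - of_nat (Suc N))"
proof -
  show "(\<Sum>r=1..N. z ^ r) * (1 - z) = z + z ^ Suc N * (- 1)"
  proof (induction N)
    case (Suc N)
    have "(\<Sum>r=1..Suc N. z ^ r) * (1 - z) = (\<Sum>r=1..N. z ^ r) * (1 - z) + z ^ Suc N * (1 - z)"
      by (simp add: distrib_right)
    also have "\<dots> = z + z ^ Suc (Suc N) * (- 1)" unfolding Suc.IH by (simp add: algebra_simps)
    finally show ?case .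
  qed simp
  show "(\<Sum>r=1..N. of_nat r * z ^ r) * (1 - z) ^ 2 = z + z ^ Suc N * (of_nat N * z - of_nat (Suc N))"
    by (induction N) (simp_all add: algebra_simps power2_eq_square)
qed

text \<open>
  Multiplication by \<open>(1 - z)\<^sup>4\<close> takes fourth differences of the coefficients; for a sequence that is
  cubic in the index only the terms at the two ends survive.
\<close>

lemma cubic_geometric_sum:
  fixes z :: "'a::comm_ring_1" and c :: "nat \<Rightarrow> 'a"
  defines "R N \<equiv> c (N+1) + (c (N+2) - 4 * c (N+1)) * z
     + (c (N+3) - 4 * c (N+2) + 6 * c (N+1)) * z ^ 2 - c N * z ^ 3"
  assumes c: "\<And>n. c (n+4) = 4 * c (n+3) - 6 * c (n+2) + 4 * c (n+1) - c n"
  shows "(\<Sum>r=1..N. c r * z ^ r) * (1 - z) ^ 4 = z * R 0 + z ^ Suc N * (- R N)"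
proof (induction N)
  case (Suc N)
  define c0 c1 c2 c3 where "c0 = c N" and "c1 = c (N+1)" and "c2 = c (N+2)" and "c3 = c (N+3)"
  have R: "R N = c1 + (c2 - 4 * c1) * z + (c3 - 4 * c2 + 6 * c1) * z ^ 2 - c0 * z ^ 3"
    "R (Suc N) = c2 + (c3 - 4 * c2) * z
      + (4 * c3 - 6 * c2 + 4 * c1 - c0 - 4 * c3 + 6 * c2) * z ^ 2 - c1 * z ^ 3"
    unfolding R_def c0_def c1_def c2_def c3_def using c[of N]
    by (simp_all add: eval_nat_numeral)
  have step: "- R N + c1 * (1 - z) ^ 4 = z * (- R (Suc N))"
    unfolding R by (simp add: algebra_simps power2_eq_square power3_eq_cube power4_eq_xxxx)
  have "(\<Sum>r=1..Suc N. c r * z ^ r) * (1 - z) ^ 4 =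
      (\<Sum>r=1..N. c r * z ^ r) * (1 - z) ^ 4 + z ^ Suc N * (c1 * (1 - z) ^ 4)"
    by (simp add: c1_def algebra_simps)
  also have "\<dots> = z * R 0 + z ^ Suc N * (- R N + c1 * (1 - z) ^ 4)"
    unfolding Suc.IH by (simp only: distrib_left add.assoc)
  also have "\<dots> = z * R 0 + z ^ Suc (Suc N) * (- R (Suc N))"
    unfolding step by (simp only: power_Suc ac_simps)
  finally show ?case .
qed simp

lemma qcong_divide_truncated_sum:
  assumes "k \<ge> 1" "S * (1 - fps_X ^ k) ^ m = T + (fps_X ^ k) ^ Suc N * R"
  shows "qcong N S (T * inverse (1 - fps_X ^ k :: real fps) ^ m)"
proof -
  let ?i = "inverse (1 - fps_X ^ k :: real fps)"
  have "S = S * ((1 - fps_X ^ k) * ?i) ^ m"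
    unfolding inverse_one_minus_X_power[OF assms(1)] by simp
  also have "\<dots> = (S * (1 - fps_X ^ k) ^ m) * ?i ^ m" by (simp only: power_mult_distrib mult.assoc)
  also have "\<dots> = (T + fps_X ^ (k * Suc N) * R) * ?i ^ m" unfolding assms(2) by (simp only: power_mult)
  also have "qcong N \<dots> ((T + 0) * ?i ^ m)"
  proof (intro cong2_mult cong2_add cong2_refl qcong_X_power_0)
    show "N < k * Suc N" using mult_le_mono1[OF assms(1), of "Suc N"]
      by (metis less_Suc_eq_le mult_1 order_less_le_trans order.refl)
  qed
  finally show ?thesis by simp
qed

lemma lambert_truncated:
  assumes "k \<ge> 1"
  shows "qcong N (\<Sum>r=1..N. (fps_X ^ k) ^ r) (lam k)"
    and "qcong N (\<Sum>r=1..N. of_nat r * (fps_X ^ k) ^ r) (dlam k)"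
    and "qcong N (\<Sum>r=1..N. (of_nat r ^ 3 - of_nat r) * (fps_X ^ k) ^ r) (6 * dlam k ^ 2)"
proof -
  show "qcong N (\<Sum>r=1..N. (fps_X ^ k) ^ r) (lam k)"
    using qcong_divide_truncated_sum[OF assms, where m = 1] geometric_sums(1)[of "fps_X ^ k :: real fps" N]
    unfolding lam_def by (metis power_one_right)
  show "qcong N (\<Sum>r=1..N. of_nat r * (fps_X ^ k) ^ r) (dlam k)"
    unfolding dlam_def by (rule qcong_divide_truncated_sum[OF assms geometric_sums(2)])
  have "qcong N (\<Sum>r=1..N. (of_nat r ^ 3 - of_nat r) * (fps_X ^ k) ^ r)
     ((6 * (fps_X ^ k) ^ 2) * inverse (1 - fps_X ^ k :: real fps) ^ 4)"
  proof (rule qcong_divide_truncated_sum[OF assms])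
    define C :: "nat \<Rightarrow> real fps" where "C r = of_nat r ^ 3 - of_nat r" for r
    have c: "C (n + 4) = 4 * C (n + 3) - 6 * C (n + 2) + 4 * C (n + 1) - C n" for n
      unfolding C_def by (simp add: algebra_simps power3_eq_cube)
    have six: "(fps_X ^ k) * (C (0+1) + (C (0+2) - 4 * C (0+1)) * (fps_X ^ k)
       + (C (0+3) - 4 * C (0+2) + 6 * C (0+1)) * (fps_X ^ k) ^ 2 - C 0 * (fps_X ^ k) ^ 3)
       = 6 * (fps_X ^ k) ^ 2"
      unfolding C_def by (simp add: power2_eq_square power3_eq_cube)
    have "(\<Sum>r=1..N. C r * (fps_X ^ k) ^ r) * (1 - fps_X ^ k) ^ 4 =
       6 * (fps_X ^ k) ^ 2 + (fps_X ^ k) ^ Suc N * (- (C (N+1) + (C (N+2) - 4 * C (N+1)) * (fps_X ^ k)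
       + (C (N+3) - 4 * C (N+2) + 6 * C (N+1)) * (fps_X ^ k) ^ 2 - C N * (fps_X ^ k) ^ 3))"
      using cubic_geometric_sum[where c = C and N = N and z = "fps_X ^ k", OF c] unfolding six .
    then show "(\<Sum>r=1..N. (of_nat r ^ 3 - of_nat r) * (fps_X ^ k) ^ r) * (1 - fps_X ^ k) ^ 4 =
       6 * (fps_X ^ k) ^ 2 + (fps_X ^ k) ^ Suc N * (- (C (N+1) + (C (N+2) - 4 * C (N+1)) * (fps_X ^ k)
       + (C (N+3) - 4 * C (N+2) + 6 * C (N+1)) * (fps_X ^ k) ^ 2 - C N * (fps_X ^ k) ^ 3))"
      unfolding C_def .
  qed
  also have "(6 * (fps_X ^ k) ^ 2) * inverse (1 - fps_X ^ k) ^ 4 = 6 * dlam k ^ 2"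
    unfolding dlam_def power_mult_distrib by (simp add: power_mult[symmetric] mult.assoc)
  finally show "qcong N (\<Sum>r=1..N. (of_nat r ^ 3 - of_nat r) * (fps_X ^ k) ^ r) (6 * dlam k ^ 2)" .
qed

text \<open>
  Both sides are truncations of the double series \<open>\<Sum> c r q\<^sup>k\<^sup>r\<close>, summed in either order.
\<close>

lemma lambert_swap:
  fixes c :: "nat \<Rightarrow> real fps"
  assumes "\<And>k. k \<ge> 1 \<Longrightarrow> qcong N (\<Sum>r=1..N. c r * (fps_X ^ k) ^ r) (f k)"
  shows "qcong N (\<Sum>k=1..N. f k) (\<Sum>r=1..N. c r * lam r)"
proof -
  have "qcong N (\<Sum>k=1..N. f k) (\<Sum>k=1..N. \<Sum>r=1..N. c r * (fps_X ^ k) ^ r)"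
    by (intro cong2_sum cong2_sym[OF assms]) auto
  also have "\<dots> = (\<Sum>r=1..N. c r * (\<Sum>k=1..N. (fps_X ^ r) ^ k))"
    unfolding sum_distrib_left power_mult[symmetric]
    by (subst sum.swap) (simp only: mult.commute)
  also have "qcong N \<dots> (\<Sum>r=1..N. c r * lam r)"
    by (intro cong2_sum cong2_mult cong2_refl lambert_truncated) auto
  finally show ?thesis .
qed

lemma e1_lam_sum: "qcong N (e1 N) (lam_sum N)"
  unfolding e1_def lam_sum_def by (rule lambert_swap) (rule lambert_truncated)

lemma dlam_square_sum:
  "qcong N (\<Sum>k=1..N. 6 * dlam k ^ 2) (\<Sum>r=1..N. (of_nat r ^ 3 - of_nat r) * lam r)"
  by (rule lambert_swap) (rule lambert_truncated)

text \<open>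
  The partial fraction identity behind Ramanujan's formula.
\<close>

lemma lam_product:
  assumes "i \<ge> 1" "j \<ge> 1"
  shows "lam i * lam j = lam (i + j) * (1 + lam i + lam j)"
proof -
  define z w where "z = (fps_X :: real fps) ^ i" and "w = (fps_X :: real fps) ^ j"
  define a b c where "a = inverse (1 - z)" and "b = inverse (1 - w)" and "c = inverse (1 - z * w)"
  have abc: "(1 - z) * a = 1" "(1 - w) * b = 1" "(1 - z * w) * c = 1"
    unfolding a_def b_def c_def z_def w_def power_add[symmetric]
    using assms by (auto intro!: inverse_one_minus_X_power)
  have l: "lam i = z * a" "lam j = w * b" "lam (i + j) = z * w * c"
    unfolding lam_def a_def b_def c_def z_def w_def power_add by simp_all
  show ?thesis unfolding l using abc by algebra
qed

lemma sum_square_triangle: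
  fixes f :: "nat \<Rightarrow> nat \<Rightarrow> 'a::comm_monoid_add"
  shows "(\<Sum>i=1..N. \<Sum>j=1..N. f i j) = (\<Sum>n=1..N. f n n) + (\<Sum>n=1..N. \<Sum>i=1..<n. f i n + f n i)"
proof (induction N)
  case (Suc N)
  have "(\<Sum>i=1..Suc N. \<Sum>j=1..Suc N. f i j) =
    (\<Sum>i=1..N. \<Sum>j=1..N. f i j) + (\<Sum>i=1..N. f i (Suc N) + f (Suc N) i) + f (Suc N) (Suc N)"
    by (simp add: sum.distrib add_ac)
  also have "(\<Sum>i=1..N. f i (Suc N) + f (Suc N) i) = (\<Sum>i=1..<Suc N. f i (Suc N) + f (Suc N) i)"
    by (rule sum.cong) auto
  finally show ?case unfolding Suc.IH by (simp add: add_ac del: sum.op_ivl_Suc)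
qed simp

lemma sum_antidiagonal:
  fixes f :: "nat \<Rightarrow> nat \<Rightarrow> 'a::comm_monoid_add"
  shows "(\<Sum>i=1..N. \<Sum>j\<in>{j\<in>{1..N}. i + j \<le> N}. f i j) = (\<Sum>n=1..N. \<Sum>i=1..<n. f i (n - i))"
proof -
  have "(\<Sum>i=1..N. \<Sum>j\<in>{j\<in>{1..N}. i + j \<le> N}. f i j) =
      (\<Sum>(i, j)\<in>(SIGMA i:{1..N}. {j\<in>{1..N}. i + j \<le> N}). f i j)"
    by (rule sum.Sigma) auto
  also have "\<dots> = (\<Sum>(n, i)\<in>(SIGMA n:{1..N}. {1..<n}). f i (n - i))"
    by (rule sum.reindex_bij_witness[of _ "\<lambda>(n, i). (i, n - i)" "\<lambda>(i, j). (i + j, i)"]) auto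
  also have "\<dots> = (\<Sum>n=1..N. \<Sum>i=1..<n. f i (n - i))"
    by (rule sum.Sigma[symmetric]) auto
  finally show ?thesis .
qed

text \<open>
  Expand \<open>\<Sum> w i j * lam i * lam j\<close> in two ways: by splitting the square of indices along its
  diagonal, and by replacing each product by \<open>lam (i + j) * (1 + lam i + lam j)\<close> and collecting
  the terms with \<open>i + j = n\<close>.
\<close>

lemma lambert_product_identity:
  fixes w :: "nat \<Rightarrow> nat \<Rightarrow> real fps"
  shows "qcong N ((\<Sum>n=1..N. w n n * (lam n * lam n)) + (\<Sum>n=1..N. \<Sum>i=1..<n. (w i n + w n i) * (lam i * lam n)))
     ((\<Sum>n=1..N. (\<Sum>i=1..<n. w i (n - i)) * lam n)
       + (\<Sum>n=1..N. \<Sum>i=1..<n. (w i (n - i) + w (n - i) i) * (lam i * lam n)))"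
proof -
  have "(\<Sum>n=1..N. w n n * (lam n * lam n)) + (\<Sum>n=1..N. \<Sum>i=1..<n. (w i n + w n i) * (lam i * lam n))
     = (\<Sum>i=1..N. \<Sum>j=1..N. w i j * (lam i * lam j))"
    unfolding sum_square_triangle by (simp add: algebra_simps)
  also have "qcong N \<dots> (\<Sum>i=1..N. \<Sum>j=1..N. if i + j \<le> N then w i j * (lam i * lam j) else 0)"
  proof (intro cong2_sum)
    fix i j
    show "qcong N (w i j * (lam i * lam j)) (if i + j \<le> N then w i j * (lam i * lam j) else 0)"
    proof (cases "i + j \<le> N")
      case False
      have "w i j * (lam i * lam j) = fps_X ^ (i + j) * (w i j * (inverse (1 - fps_X ^ i) * inverse (1 - fps_X ^ j)))"
        unfolding lam_def power_add by (simp only: ac_simps)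
      also have "qcong N \<dots> 0" using False by (intro qcong_X_power_0) simp
      finally show ?thesis using False by simp
    qed simp
  qed
  also have "\<dots> = (\<Sum>i=1..N. \<Sum>j\<in>{j\<in>{1..N}. i + j \<le> N}. w i j * (lam i * lam j))"
    by (rule sum.cong[OF refl], rule sum.inter_filter[symmetric]) simp
  also have "\<dots> = (\<Sum>n=1..N. \<Sum>i=1..<n. w i (n - i) * (lam i * lam (n - i)))"
    by (rule sum_antidiagonal)
  also have "\<dots> = (\<Sum>n=1..N. \<Sum>i=1..<n. w i (n - i) * lam n + (w i (n - i) * (lam i * lam n) + w i (n - i) * (lam (n - i) * lam n)))"
  proof (intro sum.cong refl)
    fix n i :: nat assume "i \<in> {1..<n}"
    then have "i \<ge> 1" "n - i \<ge> 1" "i + (n - i) = n" by auto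
    then have "lam i * lam (n - i) = lam n * (1 + lam i + lam (n - i))"
      using lam_product[of i "n - i"] by (simp only:)
    then show "w i (n - i) * (lam i * lam (n - i)) =
      w i (n - i) * lam n + (w i (n - i) * (lam i * lam n) + w i (n - i) * (lam (n - i) * lam n))"
      by (simp only:) (simp add: algebra_simps)
  qed
  also have "\<dots> = (\<Sum>n=1..N. (\<Sum>i=1..<n. w i (n - i)) * lam n) +
     ((\<Sum>n=1..N. \<Sum>i=1..<n. w i (n - i) * (lam i * lam n)) + (\<Sum>n=1..N. \<Sum>i=1..<n. w i (n - i) * (lam (n - i) * lam n)))"
    by (simp only: sum.distrib sum_distrib_right)
  also have "(\<Sum>n=1..N. \<Sum>i=1..<n. w i (n - i) * (lam (n - i) * lam n)) = (\<Sum>n=1..N. \<Sum>i=1..<n. w (n - i) i * (lam i * lam n))"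
  proof (rule sum.cong[OF refl])
    fix n
    show "(\<Sum>i=1..<n. w i (n - i) * (lam (n - i) * lam n)) = (\<Sum>i=1..<n. w (n - i) i * (lam i * lam n))"
      by (rule sum.reindex_bij_witness[of _ "\<lambda>i. n - i" "\<lambda>i. n - i"]) auto
  qed
  finally show ?thesis by (simp only: sum.distrib distrib_right)
qed

lemma power_sums:
  fixes n :: nat
  shows "6 * (\<Sum>i=1..<n. of_nat i * of_nat (n - i)) = (of_nat n ^ 3 - of_nat n :: 'a::comm_ring_1)"
    and "6 * (\<Sum>i=1..<n. of_nat i ^ 2) = (2 * of_nat n ^ 3 - 3 * of_nat n ^ 2 + of_nat n :: 'a)"
proof -
  have 2: "6 * (\<Sum>i=1..<n. of_nat i ^ 2) = (2 * of_nat n ^ 3 - 3 * of_nat n ^ 2 + of_nat n :: 'a)" for n :: nat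
  proof (induction n)
    case (Suc n)
    then show ?case
      by (cases "n = 0") (simp_all add: algebra_simps power2_eq_square power3_eq_cube)
  qed simp
  have 1: "2 * (\<Sum>i=1..<n. of_nat i) = (of_nat n ^ 2 - of_nat n :: 'a)" for n :: nat
  proof (induction n)
    case (Suc n)
    then show ?case
      by (cases "n = 0") (simp_all add: algebra_simps power2_eq_square)
  qed simp
  show "6 * (\<Sum>i=1..<n. of_nat i ^ 2) = (2 * of_nat n ^ 3 - 3 * of_nat n ^ 2 + of_nat n :: 'a)" by (rule 2)
  have "(\<Sum>i=1..<n. of_nat i * of_nat (n - i)) = (\<Sum>i=1..<n. of_nat n * of_nat i - of_nat i ^ 2 :: 'a)"
    by (intro sum.cong refl) (simp add: of_nat_diff algebra_simps power2_eq_square)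
  also have "\<dots> = of_nat n * (\<Sum>i=1..<n. of_nat i) - (\<Sum>i=1..<n. of_nat i ^ 2)"
    by (simp only: sum_subtractf sum_distrib_left)
  finally have "6 * (\<Sum>i=1..<n. of_nat i * of_nat (n - i) :: 'a) =
      3 * of_nat n * (2 * (\<Sum>i=1..<n. of_nat i)) - 6 * (\<Sum>i=1..<n. of_nat i ^ 2)"
    by (simp only: right_diff_distrib) (simp add: mult_ac)
  then show "6 * (\<Sum>i=1..<n. of_nat i * of_nat (n - i)) = (of_nat n ^ 3 - of_nat n :: 'a)"
    unfolding 1 2 by (simp add: algebra_simps power2_eq_square power3_eq_cube)
qed

text \<open>
  Use the product identity with the weights \<open>w i j = i j\<close> and \<open>w i j = i\<^sup>2\<close>.  With
  \<open>X = \<Sum> i\<^sup>2 lam i lam n\<close> and \<open>Y = \<Sum> i n lam i lam n\<close> over \<open>i < n\<close>, and \<open>Z = \<Sum> n\<^sup>2 (lam n)\<^sup>2\<close>, they evaluate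
  \<open>Z + 2 X\<close> and \<open>Z + 2 Y - X\<close> as sums over a single \<open>lam n\<close>.  Eliminating \<open>X\<close> expresses \<open>Z + 2 Y\<close>, which is
  congruent to \<open>e1\<^sup>2\<close>, by such sums and \<open>Z\<close>.
\<close>

lemma ramanujan_identity:
  "qcong N (12 * e1 N ^ 2)
     (5 * (\<Sum>k=1..N. 6 * dlam k ^ 2) + 6 * e1 N - 6 * (\<Sum>k=1..N. of_nat k ^ 2 * dlam k))"
proof -
  define X Y Z where "X = (\<Sum>n=1..N. \<Sum>i=1..<n. of_nat i ^ 2 * (lam i * lam n))"
    and "Y = (\<Sum>n=1..N. \<Sum>i=1..<n. of_nat i * of_nat n * (lam i * lam n))"
    and "Z = (\<Sum>n=1..N. of_nat n ^ 2 * (lam n * lam n))"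
  define C where "C = (\<Sum>n=1..N. (of_nat n ^ 3 - of_nat n) * lam n)"
  define V where "V = (\<Sum>n=1..N. of_nat n ^ 2 * lam n)"
  define p where "p = (\<Sum>n=1..N. (\<Sum>i=1..<n. of_nat i * of_nat (n - i)) * lam n)"
  define r where "r = (\<Sum>n=1..N. (\<Sum>i=1..<n. of_nat i ^ 2) * lam n)"
  have pC: "6 * p = C"
    unfolding p_def C_def power_sums(1)[symmetric] mult.assoc by (rule sum_distrib_left)
  have rC: "6 * r = 2 * C - 3 * V + 3 * lam_sum N"
  proof -
    have "6 * r = (\<Sum>n=1..N. (2 * of_nat n ^ 3 - 3 * of_nat n ^ 2 + of_nat n) * lam n)"
      unfolding r_def power_sums(2)[symmetric] mult.assoc by (rule sum_distrib_left)
    also have "\<dots> = 2 * C - 3 * V + 3 * lam_sum N"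
      unfolding C_def V_def lam_sum_def sum_distrib_left sum_subtractf[symmetric] sum.distrib[symmetric]
      by (intro sum.cong refl) (simp add: algebra_simps)
    finally show ?thesis .
  qed
  have sq: "lam_sum N ^ 2 = Z + 2 * Y"
    unfolding power2_eq_square lam_sum_def sum_product sum_square_triangle
    unfolding Z_def Y_def sum_distrib_left
    by (intro arg_cong2[of _ _ _ _ "(+)"] sum.cong refl) (simp_all add: algebra_simps power2_eq_square)
  have A: "qcong N (Z + 2 * Y) (p + (2 * Y - 2 * X))"
  proof -
    have l: "(\<Sum>n=1..N. \<Sum>i=1..<n. (of_nat i * of_nat n + of_nat n * of_nat i) * (lam i * lam n)) = 2 * Y"
      unfolding Y_def sum_distrib_left by (intro sum.cong refl) (simp add: algebra_simps)
    have r: "(\<Sum>n=1..N. \<Sum>i=1..<n. (of_nat i * of_nat (n - i) + of_nat (n - i) * of_nat i) * (lam i * lam n)) = 2 * Y - 2 * X"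
      unfolding Y_def X_def sum_distrib_left sum_subtractf[symmetric]
      by (intro sum.cong refl) (simp add: of_nat_diff algebra_simps power2_eq_square)
    show ?thesis using lambert_product_identity[of N "\<lambda>i j. of_nat i * of_nat j"]
      unfolding l r p_def Z_def power2_eq_square .
  qed
  have B: "qcong N (Z + (X + (\<Sum>n=1..N. \<Sum>i=1..<n. of_nat n ^ 2 * (lam i * lam n))))
     (r + (2 * X - 2 * Y + (\<Sum>n=1..N. \<Sum>i=1..<n. of_nat n ^ 2 * (lam i * lam n))))"
  proof -
    have l: "(\<Sum>n=1..N. \<Sum>i=1..<n. (of_nat i ^ 2 + of_nat n ^ 2) * (lam i * lam n)) =
        X + (\<Sum>n=1..N. \<Sum>i=1..<n. of_nat n ^ 2 * (lam i * lam n))"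
      unfolding X_def sum.distrib[symmetric] by (intro sum.cong refl) (simp add: algebra_simps)
    have r: "(\<Sum>n=1..N. \<Sum>i=1..<n. (of_nat i ^ 2 + of_nat (n - i) ^ 2) * (lam i * lam n)) =
        2 * X - 2 * Y + (\<Sum>n=1..N. \<Sum>i=1..<n. of_nat n ^ 2 * (lam i * lam n))"
      unfolding X_def Y_def sum_distrib_left sum_subtractf[symmetric] sum.distrib[symmetric]
      by (intro sum.cong refl) (simp add: of_nat_diff algebra_simps power2_eq_square)
    show ?thesis using lambert_product_identity[of N "\<lambda>i j. of_nat i ^ 2"]
      unfolding l r r_def Z_def .
  qed
  \<comment> \<open>this sum enters both sides of \<open>B\<close> and cancels\<close>
  define W where "W = (\<Sum>n=1..N. \<Sum>i=1..<n. of_nat n ^ 2 * (lam i * lam n))"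
  have "qcong N (12 * e1 N ^ 2) (12 * lam_sum N ^ 2)"
    by (intro cong2_mult cong2_power e1_lam_sum cong2_refl)
  also have "12 * lam_sum N ^ 2 = 12 * (Z + (X + W)) + 6 * (Z + 2 * Y) - 6 * Z - 12 * X - 12 * W + 12 * Y"
    unfolding sq by (simp add: algebra_simps)
  also have "qcong N \<dots> (12 * (r + (2 * X - 2 * Y + W)) + 6 * (p + (2 * Y - 2 * X)) - 6 * Z - 12 * X - 12 * W + 12 * Y)"
    unfolding W_def by (intro cong2_add cong2_diff cong2_mult cong2_refl A B)
  also have "\<dots> = 2 * (6 * r) + 6 * p - 6 * Z" by (simp add: algebra_simps)
  also have "\<dots> = 5 * C + 6 * lam_sum N - 6 * (V + Z)"
    unfolding rC pC by (simp add: algebra_simps)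
  also have "V + Z = (\<Sum>k=1..N. of_nat k ^ 2 * dlam k)"
    unfolding V_def Z_def sum.distrib[symmetric]
    by (intro sum.cong refl) (simp add: dlam_eq distrib_left power2_eq_square)
  also have "qcong N (5 * C + 6 * lam_sum N - 6 * (\<Sum>k=1..N. of_nat k ^ 2 * dlam k))
     (5 * (\<Sum>k=1..N. 6 * dlam k ^ 2) + 6 * e1 N - 6 * (\<Sum>k=1..N. of_nat k ^ 2 * dlam k))"
    unfolding C_def
    by (intro cong2_add cong2_diff cong2_mult cong2_refl cong2_sym[OF e1_lam_sum] cong2_sym[OF dlam_square_sum])
  finally show ?thesis .
qed

section \<open>Truncated expansions\<close>

text \<open>
  Series in \<open>q\<close> whose coefficients become constants of a larger coefficient ring.  The rank and crank
  series live over the ring of power series in \<open>u\<close>, where \<open>x = 1 + u\<close> is invertible.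
\<close>

definition lift_fps :: "'a::comm_ring_1 fps \<Rightarrow> 'a fps fps" where
  "lift_fps f = Abs_fps (\<lambda>n. fps_const (fps_nth f n))"

lemma lift_fps_nth [simp]: "fps_nth (lift_fps f) n = fps_const (fps_nth f n)"
  by (simp add: lift_fps_def)

lemma fps_const_sum: "fps_const (sum f A) = (\<Sum>i\<in>A. fps_const (f i :: 'a::comm_ring_1))"
  by (induction A rule: infinite_finite_induct) (simp_all add: fps_const_add[symmetric] del: fps_const_add)

lemma lift_fps_add: "lift_fps (f + g) = lift_fps f + lift_fps g"
  by (rule fps_ext) simp

lemma lift_fps_diff: "lift_fps (f - g) = lift_fps f - lift_fps g"
  by (rule fps_ext) simp

lemma lift_fps_mult: "lift_fps (f * g) = lift_fps f * lift_fps g"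
  by (rule fps_ext) (simp add: fps_mult_nth fps_const_sum)

lemma lift_fps_0 [simp]: "lift_fps 0 = 0"
  by (rule fps_ext) simp

lemma lift_fps_1 [simp]: "lift_fps 1 = 1"
  by (rule fps_ext) simp

lemma lift_fps_X_power: "lift_fps (fps_X ^ k) = fps_X ^ k"
  by (rule fps_ext) simp

lemma lift_fps_sum: "lift_fps (sum f A) = (\<Sum>i\<in>A. lift_fps (f i))"
  by (induction A rule: infinite_finite_induct) (simp_all add: lift_fps_add)

lemma lift_fps_prod: "lift_fps (prod f A) = (\<Prod>i\<in>A. lift_fps (f i))"
  by (induction A rule: infinite_finite_induct) (simp_all add: lift_fps_mult)

lemma lift_fps_power: "lift_fps (f ^ n) = lift_fps f ^ n"
  by (induction n) (simp_all add: lift_fps_mult)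

lemma lift_fps_qprod_1: "lift_fps (qprod A 1) = qprod A 1"
  by (simp add: qprod_def lift_fps_prod lift_fps_diff lift_fps_X_power)

lemmas lift_fps_simps = lift_fps_add lift_fps_diff lift_fps_mult lift_fps_power

context
  fixes b :: "nat \<Rightarrow> 'a::comm_ring_1" and u T :: 'a
begin

lemma cong2_cube: "cong2 u (T ^ 3) (f + T ^ 3 * g) f"
  unfolding cong2_def by (rule exI[of _ 0], rule exI[of _ g]) simp

text \<open>
  Modulo \<open>T\<^sup>3\<close> the inverse of a product of factors \<open>1 + T b\<^sub>k\<close> is its expansion in complete homogeneous
  symmetric functions.
\<close>

lemma prod_one_plus_inverse:
  "cong2 u (T ^ 3) ((\<Prod>k=1..n. 1 + T * b k) *
     (1 - T * (\<Sum>k=1..n. b k) + T ^ 2 * (\<Sum>j=1..n. b j * (\<Sum>i=1..j. b i)))) 1"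
proof (induction n)
  case 0
  then show ?case by simp
next
  case (Suc n)
  define e h where "e = (\<Sum>k=1..n. b k)" and "h = (\<Sum>j=1..n. b j * (\<Sum>i=1..j. b i))"
  define p where "p = (\<Prod>k=1..n. 1 + T * b k)"
  define c where "c = b (Suc n)"
  have "(1 + T * c) * (1 - T * (e + c) + T ^ 2 * (h + c * (e + c))) =
     (1 - T * e + T ^ 2 * h) + T ^ 3 * (c * (h + c * (e + c)))"
    by (simp add: algebra_simps power2_eq_square power3_eq_cube)
  then have "p * (1 + T * c) * (1 - T * (e + c) + T ^ 2 * (h + c * (e + c))) =
     p * ((1 - T * e + T ^ 2 * h) + T ^ 3 * (c * (h + c * (e + c))))" by (simp only: mult.assoc)
  also have "cong2 u (T ^ 3) \<dots> (p * (1 - T * e + T ^ 2 * h))"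
    by (intro cong2_mult cong2_refl cong2_cube)
  also have "cong2 u (T ^ 3) \<dots> 1" using Suc.IH unfolding p_def e_def h_def .
  finally show ?case unfolding p_def e_def h_def c_def
    by (simp add: mult.commute)
qed

lemma prod_one_plus_linear:
  "\<exists>r. (\<Prod>k=1..n. 1 + T * b k) = 1 + T * (\<Sum>k=1..n. b k) + T ^ 2 * r"
proof (induction n)
  case 0
  then show ?case by (intro exI[of _ 0]) simp
next
  case (Suc n)
  then obtain r where r: "(\<Prod>k=1..n. 1 + T * b k) = 1 + T * (\<Sum>k=1..n. b k) + T ^ 2 * r" by blast
  have "(\<Prod>k=1..Suc n. 1 + T * b k) = (\<Prod>k=1..n. 1 + T * b k) * (1 + T * b (Suc n))" by simp
  also have "\<dots> = 1 + T * (\<Sum>k=1..Suc n. b k)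
      + T ^ 2 * (r + b (Suc n) * (\<Sum>k=1..n. b k) + T * r * b (Suc n))"
    unfolding r by (simp add: algebra_simps power2_eq_square)
  finally show ?case by blast
qed

end

lemma quadratic_product:
  "cong2 u (T ^ 3) ((1 + T * a1 + T ^ 2 * a2) * (1 - T * b1 + T ^ 2 * b2))
     (1 + T * (a1 - b1) + T ^ 2 * (a2 - a1 * b1 + b2))"
proof -
  have "(1 + T * a1 + T ^ 2 * a2) * (1 - T * b1 + T ^ 2 * b2) =
    (1 + T * (a1 - b1) + T ^ 2 * (a2 - a1 * b1 + b2)) + T ^ 3 * (a1 * b2 - a2 * b1 + T * a2 * b2)"
    by (simp add: algebra_simps power2_eq_square power3_eq_cube)
  then show ?thesis using cong2_cube[of u T] by simp
qed

section \<open>Expansion of the rank and crank series in t\<close>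

text \<open>
  For \<open>xy = 1\<close> the parameter \<open>T\<close> is \<open>(1 - x)(1 - y)\<close>.
\<close>

context
  fixes x y :: "real fps" and T :: "real fps fps"
  assumes xy: "x * y = 1"
  defines "T \<equiv> fps_const (2 - x - y)"
begin

abbreviation ldlam :: "nat \<Rightarrow> real fps fps" where
  "ldlam k \<equiv> lift_fps (dlam k)"

text \<open>
  With \<open>xy = 1\<close> the left side is \<open>(1 - q\<^sup>k)\<^sup>2 + (2 - x - y) q\<^sup>k\<close>.
\<close>

lemma quadratic_factor:
  assumes "k \<ge> 1"
  shows "(1 - fps_const x * fps_X ^ k) * (1 - fps_const y * fps_X ^ k) =
     lift_fps (1 - fps_X ^ k) ^ 2 * (1 + T * ldlam k)"
proof -
  have "dlam k * (1 - fps_X ^ k) ^ 2 = fps_X ^ k * ((1 - fps_X ^ k) * inverse (1 - fps_X ^ k)) ^ 2"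
    unfolding dlam_def power_mult_distrib by (simp only: ac_simps)
  then have "dlam k * (1 - fps_X ^ k) ^ 2 = fps_X ^ k"
    unfolding inverse_one_minus_X_power[OF assms] by simp
  then have "lift_fps (dlam k * (1 - fps_X ^ k) ^ 2) = fps_X ^ k"
    by (simp only: lift_fps_X_power)
  then have d: "ldlam k * lift_fps (1 - fps_X ^ k) ^ 2 = fps_X ^ k"
    by (simp only: lift_fps_simps)
  have T: "T = 2 - fps_const x - fps_const y"
    unfolding T_def by (simp add: fps_const_sub[symmetric] fps_numeral_fps_const del: fps_const_sub)
  have xy': "fps_const x * fps_const y = 1" using xy by simp
  have "lift_fps (1 - fps_X ^ k) ^ 2 * (1 + T * ldlam k)
     = lift_fps (1 - fps_X ^ k) ^ 2 + T * (ldlam k * lift_fps (1 - fps_X ^ k) ^ 2)"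
    by (simp add: algebra_simps)
  also have "\<dots> = (1 - fps_X ^ k) ^ 2 + T * fps_X ^ k"
    unfolding d by (simp add: lift_fps_diff lift_fps_X_power)
  also have "\<dots> = (1 - fps_const x * fps_X ^ k) * (1 - fps_const y * fps_X ^ k)"
  proof -
    have "(1 - z) ^ 2 + (2 - a - b) * z = (1 - a * z) * (1 - b * z) + (1 - a * b) * z ^ 2"
      for a b z :: "real fps fps"
      by (simp add: algebra_simps power2_eq_square)
    from this[of "fps_X ^ k" "fps_const x" "fps_const y"] show ?thesis
      unfolding T xy' by (simp only: diff_self mult_zero_left add_0_right)
  qed
  finally show ?thesis ..
qed

lemma qprod_pair:
  "qprod {1..n} (fps_const x) * qprod {1..n} (fps_const y) =
     lift_fps (euler n) ^ 2 * (\<Prod>k=1..n. 1 + T * ldlam k)"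
proof -
  have "qprod {1..n} (fps_const x) * qprod {1..n} (fps_const y) =
    (\<Prod>k=1..n. lift_fps (1 - fps_X ^ k) ^ 2 * (1 + T * ldlam k))"
    unfolding qprod_def prod.distrib[symmetric]
    by (intro prod.cong refl quadratic_factor) auto
  also have "\<dots> = (\<Prod>k=1..n. lift_fps (1 - fps_X ^ k)) ^ 2 * (\<Prod>k=1..n. 1 + T * ldlam k)"
    by (simp only: prod.distrib prod_power_distrib)
  also have "(\<Prod>k=1..n. lift_fps (1 - fps_X ^ k)) = lift_fps (euler n)"
    unfolding euler_def qprod_def lift_fps_prod by simp
  finally show ?thesis .
qed

lemma lift_euler_inverse: "lift_fps (euler N) * lift_fps (inverse (euler N)) = 1"
  by (simp add: lift_fps_mult[symmetric])

lemma divide_by_qprod_pair: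
  assumes "qcong N (F * (qprod {1..N} (fps_const x) * qprod {1..N} (fps_const y))) G"
  shows "cong2 (fps_X ^ Suc N) (T ^ 3) F
     (lift_fps (inverse (euler N)) ^ 2 * G * (1 - T * lift_fps (e1 N) + T ^ 2 * lift_fps (h2 N)))"
proof -
  let ?c = "cong2 (fps_X ^ Suc N) (T ^ 3)"
  let ?E = "lift_fps (euler N)" and ?P = "lift_fps (inverse (euler N))"
  let ?p = "\<Prod>k=1..N. 1 + T * ldlam k"
  have eh: "lift_fps (e1 N) = (\<Sum>k=1..N. ldlam k)"
    "lift_fps (h2 N) = (\<Sum>j=1..N. ldlam j * (\<Sum>i=1..j. ldlam i))"
    by (simp_all only: e1_def h2_def lift_fps_sum lift_fps_mult)
  let ?q = "1 - T * lift_fps (e1 N) + T ^ 2 * lift_fps (h2 N)"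
  have "?c (?P ^ 2 * G * ?q)
      (?P ^ 2 * (F * (qprod {1..N} (fps_const x) * qprod {1..N} (fps_const y))) * ?q)"
    by (intro cong2_mult cong2_refl cong2_weaken[OF cong2_sym[OF assms]])
  also have "\<dots> = F * (?E * ?P) ^ 2 * (?p * ?q)"
    unfolding qprod_pair power_mult_distrib by (simp only: ac_simps)
  also have "\<dots> = F * (?p * ?q)" unfolding lift_euler_inverse by simp
  also have "?c \<dots> (F * 1)"
    unfolding eh by (intro cong2_mult cong2_refl prod_one_plus_inverse)
  finally show ?thesis by (simp add: cong2_sym)
qed

lemma crank_expansion:
  assumes "N \<ge> 1"
  shows "cong2 (fps_X ^ Suc N) (T ^ 3) (crank_gf x y)
     (lift_fps (inverse (euler N)) + T * lift_fps (- (inverse (euler N) * e1 N))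
       + T ^ 2 * lift_fps (inverse (euler N) * h2 N))"
proof -
  let ?P = "lift_fps (inverse (euler N))"
  have "cong2 (fps_X ^ Suc N) (T ^ 3) (crank_gf x y)
     (?P ^ 2 * qprod {1..N} 1 * (1 - T * lift_fps (e1 N) + T ^ 2 * lift_fps (h2 N)))"
    by (rule divide_by_qprod_pair[OF crank_gf_product[OF xy assms]])
  also have "?P ^ 2 * qprod {1..N} 1 = ?P * (lift_fps (euler N) * ?P)"
    unfolding euler_def lift_fps_qprod_1 by (simp add: power2_eq_square mult_ac)
  also have "\<dots> = ?P" unfolding lift_euler_inverse by simp
  also have "?P * (1 - T * lift_fps (e1 N) + T ^ 2 * lift_fps (h2 N)) =
    ?P + T * lift_fps (- (inverse (euler N) * e1 N)) + T ^ 2 * lift_fps (inverse (euler N) * h2 N)"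
    using lift_fps_diff[of 0 "inverse (euler N) * e1 N"]
    by (simp add: lift_fps_mult algebra_simps)
  finally show ?thesis .
qed

text \<open>
  These two series are the coefficients of \<open>T\<close> and \<open>T\<^sup>2\<close> in the Heine sum divided by \<open>(q)\<^sub>N\<close>.
\<close>

definition heine_coeff1 :: "nat \<Rightarrow> real fps" where
  "heine_coeff1 N = (\<Sum>k=1..N. dlam k * euler k)"

definition heine_coeff2 :: "nat \<Rightarrow> real fps" where
  "heine_coeff2 N = (\<Sum>k=1..N. dlam k * euler k * e1 (k - 1))"

lemma spt2_sum_eq: "spt2_sum N = e1 N * heine_coeff1 N - heine_coeff2 N"
  by (induction N) (simp_all add: spt2_sum_def e1_def heine_coeff1_def heine_coeff2_def algebra_simps)

text \<open>
  The \<open>n\<close>-th term contains \<open>(x)\<^sub>n (y)\<^sub>n\<close>, that is, \<open>T\<close> times the product of the quadratic factors for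
  \<open>k < n\<close>; so the expansion of that product is needed to first order only.
\<close>

lemma heine_expansion:
  "cong2 (fps_X ^ Suc N) (T ^ 3) (heine_sum N (fps_const x) (fps_const y))
     (lift_fps (euler N) * (1 + T * lift_fps (heine_coeff1 N) + T ^ 2 * lift_fps (heine_coeff2 N)))"
proof -
  let ?c = "cong2 (fps_X ^ Suc N) (T ^ 3)"
  let ?E = "lift_fps (euler N)"
  let ?g = "\<lambda>n. qprod {..<n} (fps_const x) * qprod {..<n} (fps_const y) * fps_X ^ n * qprod {n<..N} 1"
  have summand: "?c (?g n) (?E * (T * lift_fps (dlam n * euler n) + T ^ 2 * lift_fps (dlam n * euler n * e1 (n - 1))))"
    if n: "n \<in> {1..N}" for n
  proof -
    obtain m where m: "n = Suc m" using n by (cases n) auto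
    have n1: "n - 1 = m" using m by simp
    define i where "i = inverse (1 - fps_X ^ n :: real fps)"
    have i: "(1 - fps_X ^ n) * i = 1" unfolding i_def by (rule inverse_one_minus_X_power) (use n in auto)
    have "euler N = euler n * qprod {n<..N} 1"
      unfolding euler_def by (rule qprod_split) (use n in auto)
    moreover have "euler n = euler m * (1 - fps_X ^ n)" unfolding m by (rule euler_Suc)
    ultimately have "euler N * (dlam n * euler n) =
       euler m ^ 2 * fps_X ^ n * qprod {n<..N} 1 * ((1 - fps_X ^ n) * i) ^ 2"
      unfolding dlam_def i_def[symmetric] power2_eq_square by (simp only: ac_simps)
    then have real: "euler m ^ 2 * fps_X ^ n * qprod {n<..N} 1 = euler N * (dlam n * euler n)"
      unfolding i by simp
    have "lift_fps (euler m ^ 2 * fps_X ^ n * qprod {n<..N} 1) = ?E * lift_fps (dlam n * euler n)"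
      unfolding real by (rule lift_fps_mult)
    then have lift: "lift_fps (euler m) ^ 2 * fps_X ^ n * qprod {n<..N} 1 = ?E * lift_fps (dlam n * euler n)"
      by (simp only: power2_eq_square lift_fps_mult lift_fps_X_power lift_fps_qprod_1)
    have tt: "(1 - fps_const x) * (1 - fps_const y) = T"
    proof -
      have "(1 - x) * (1 - y) = 2 - x - y" using xy by (simp add: algebra_simps)
      then show ?thesis unfolding T_def by (metis fps_const_1_eq_1 fps_const_mult fps_const_sub)
    qed
    obtain r where r: "(\<Prod>k=1..m. 1 + T * ldlam k) = 1 + T * (\<Sum>k=1..m. ldlam k) + T ^ 2 * r"
      using prod_one_plus_linear[where T = T and b = ldlam and n = m] by blast
    have e: "(\<Sum>k=1..m. ldlam k) = lift_fps (e1 m)" by (simp only: e1_def lift_fps_sum)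
    have "?g n = (1 - fps_const x) * (1 - fps_const y) *
        (qprod {1..m} (fps_const x) * qprod {1..m} (fps_const y)) * fps_X ^ n * qprod {n<..N} 1"
      unfolding m qprod_pull_first by (simp only: ac_simps)
    also have "\<dots> = T * (\<Prod>k=1..m. 1 + T * ldlam k) * (lift_fps (euler m) ^ 2 * fps_X ^ n * qprod {n<..N} 1)"
      unfolding tt qprod_pair by (simp only: ac_simps)
    also have "\<dots> = ?E * (T * lift_fps (dlam n * euler n) + T ^ 2 * lift_fps (dlam n * euler n * e1 (n - 1)))
       + T ^ 3 * (r * (?E * lift_fps (dlam n * euler n)))"
      unfolding lift r e n1
      by (simp add: algebra_simps power2_eq_square power3_eq_cube lift_fps_mult del: power_Suc)
    finally show ?thesis by (simp only: cong2_cube)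
  qed
  have "{..N} = insert 0 {1..N}" by auto
  then have "heine_sum N (fps_const x) (fps_const y) = qprod {0<..N} 1 + (\<Sum>n=1..N. ?g n)"
    unfolding heine_sum_def by simp
  also have "{0<..N} = {1..N}" by auto
  also have "qprod {1..N} 1 = ?E" unfolding euler_def lift_fps_qprod_1 ..
  also have "?c (?E + (\<Sum>n=1..N. ?g n)) (?E + (\<Sum>n=1..N. ?E * (T * lift_fps (dlam n * euler n) + T ^ 2 * lift_fps (dlam n * euler n * e1 (n - 1)))))"
    by (intro cong2_add cong2_sum cong2_refl summand)
  also have "\<dots> = ?E * (1 + T * lift_fps (heine_coeff1 N) + T ^ 2 * lift_fps (heine_coeff2 N))"
    unfolding heine_coeff1_def heine_coeff2_def lift_fps_sum by (simp add: distrib_left sum.distrib sum_distrib_left)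
  finally show ?thesis .
qed

lemma rank_expansion:
  "cong2 (fps_X ^ Suc N) (T ^ 3) (joint_gf y x)
     (lift_fps (inverse (euler N)) + T * lift_fps (inverse (euler N) * (heine_coeff1 N - e1 N))
       + T ^ 2 * lift_fps (inverse (euler N) * (h2 N - spt2_sum N)))"
proof -
  let ?c = "cong2 (fps_X ^ Suc N) (T ^ 3)"
  let ?P = "lift_fps (inverse (euler N))"
  let ?q = "1 - T * lift_fps (e1 N) + T ^ 2 * lift_fps (h2 N)"
  have "heine_sum N (fps_const y) (fps_const x) = heine_sum N (fps_const x) (fps_const y)"
    unfolding heine_sum_def by (simp only: mult.commute)
  then have "qcong N (joint_gf y x * (qprod {1..N} (fps_const x) * qprod {1..N} (fps_const y)))
     (heine_sum N (fps_const x) (fps_const y))"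
    using joint_gf_heine[of N y x] by (simp only: mult.commute)
  then have "?c (joint_gf y x) (?P ^ 2 * heine_sum N (fps_const x) (fps_const y) * ?q)"
    by (rule divide_by_qprod_pair)
  also have "?c \<dots> (?P ^ 2 * (lift_fps (euler N) * (1 + T * lift_fps (heine_coeff1 N) + T ^ 2 * lift_fps (heine_coeff2 N))) * ?q)"
    by (intro cong2_mult cong2_refl heine_expansion)
  also have "\<dots> = (lift_fps (euler N) * ?P) * (?P * ((1 + T * lift_fps (heine_coeff1 N) + T ^ 2 * lift_fps (heine_coeff2 N)) * ?q))"
    by (simp only: power2_eq_square ac_simps)
  also have "\<dots> = ?P * ((1 + T * lift_fps (heine_coeff1 N) + T ^ 2 * lift_fps (heine_coeff2 N)) * ?q)"
    unfolding lift_euler_inverse by simp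
  also have "?c \<dots> (?P * (1 + T * (lift_fps (heine_coeff1 N) - lift_fps (e1 N))
      + T ^ 2 * (lift_fps (heine_coeff2 N) - lift_fps (heine_coeff1 N) * lift_fps (e1 N) + lift_fps (h2 N))))"
    by (intro cong2_mult cong2_refl quadratic_product)
  also have "\<dots> = ?P + T * lift_fps (inverse (euler N) * (heine_coeff1 N - e1 N))
       + T ^ 2 * lift_fps (inverse (euler N) * (h2 N - spt2_sum N))"
    unfolding spt2_sum_eq by (simp add: lift_fps_simps algebra_simps)
  finally show ?thesis .
qed

end

section \<open>Moments as coefficients\<close>

text \<open>
  The powers of \<open>x = 1 + u\<close>, for which the coefficient of \<open>u\<^sup>k\<close> in \<open>x\<^sup>m\<close> is the binomial coefficient of
  \<open>m\<close> over \<open>k\<close>.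
\<close>

definition xpow :: "int \<Rightarrow> real fps" where
  "xpow m = fps_binomial (of_int m)"

lemma xpow_add: "xpow (m + n) = xpow m * xpow n"
  by (simp add: xpow_def fps_binomial_add_mult)

lemma xpow_0 [simp]: "xpow 0 = 1"
  by (simp add: xpow_def)

lemma xpow_1: "xpow 1 = 1 + fps_X"
  unfolding xpow_def using fps_binomial_of_nat[of 1, where 'a = real] by simp

lemma xpow_inverse: "xpow 1 * xpow (- 1) = 1"
  by (simp add: xpow_add[symmetric])

lemma xpow_nat: "xpow 1 ^ n = xpow (int n)" "xpow (- 1) ^ n = xpow (- int n)"
  by (induction n) (simp_all add: xpow_add[symmetric])

lemma xpow_t: "2 - xpow 1 - xpow (- 1) = - (fps_X ^ 2 * xpow (- 1))"
proof -
  have "2 - xpow 1 - xpow (- 1) = (2 - xpow 1 - xpow (- 1)) * (xpow 1 * xpow (- 1))"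
    unfolding xpow_inverse by simp
  also have "\<dots> = (2 * xpow 1 - xpow 1 ^ 2 - xpow 1 * xpow (- 1)) * xpow (- 1)"
    by (simp add: algebra_simps power2_eq_square)
  also have "\<dots> = - (fps_X ^ 2 * xpow (- 1))"
    unfolding xpow_inverse unfolding xpow_1 by (simp add: algebra_simps power2_eq_square)
  finally show ?thesis .
qed

text \<open>
  As \<open>t = - u\<^sup>2 / x\<close>, the product \<open>x t\<^sup>k\<close> equals \<open>(-1)\<^sup>k u\<^sup>2\<^sup>k x\<^sup>1\<^sup>-\<^sup>k\<close>.  Hence only the term \<open>x t\<^sup>2\<close> contributes to
  the coefficient of \<open>u\<^sup>4\<close> and nothing to that of \<open>u\<^sup>3\<close>.  Without the factor \<open>x\<close>, the coefficient of \<open>u\<^sup>2\<close>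
  comes from \<open>t\<close> alone.
\<close>

lemma symmetric_expansion_nth:
  assumes F: "cong2 (fps_X ^ Suc N) (fps_const (2 - xpow 1 - xpow (- 1)) ^ 3) F
     (lift_fps F0 + fps_const (2 - xpow 1 - xpow (- 1)) * lift_fps F1
       + fps_const (2 - xpow 1 - xpow (- 1)) ^ 2 * lift_fps F2)"
    and n: "n \<le> N"
  shows "fps_nth (fps_nth F n) 1 = 0"
    and "fps_nth (fps_nth F n) 2 = - fps_nth F1 n"
    and "fps_nth (xpow 1 * fps_nth F n) 3 = 0"
    and "fps_nth (xpow 1 * fps_nth F n) 4 = fps_nth F2 n"
proof -
  define y where "y = xpow (- 1)"
  define X where "X = (fps_X :: real fps)"
  define t where "t = 2 - xpow 1 - xpow (- 1)"
  have t: "t = - (X ^ 2 * y)" unfolding t_def X_def y_def by (rule xpow_t)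
  have y0: "fps_nth y 0 = 1" unfolding y_def xpow_def by simp
  obtain a b where ab: "F - (lift_fps F0 + fps_const t * lift_fps F1 + fps_const t ^ 2 * lift_fps F2)
      = fps_X ^ Suc N * a + fps_const t ^ 3 * b"
    using F unfolding cong2_def t_def by blast
  have "fps_nth (F - (lift_fps F0 + fps_const t * lift_fps F1 + fps_const t ^ 2 * lift_fps F2)) n
      = t ^ 3 * fps_nth b n"
    unfolding ab fps_add_nth fps_X_power_mult_nth using n by (simp add: fps_const_power)
  then have Fn: "fps_nth F n = fps_const (fps_nth F0 n) + t * fps_const (fps_nth F1 n)
      + t ^ 2 * fps_const (fps_nth F2 n) + t ^ 3 * fps_nth b n"
    by (simp add: fps_const_power algebra_simps)
  define c0 c1 c2 r where "c0 = fps_nth F0 n" and "c1 = fps_nth F1 n" and "c2 = fps_nth F2 n"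
    and "r = y ^ 3 * fps_nth b n"
  have Fn': "fps_nth F n = fps_const c0 - X ^ 2 * (y * fps_const c1)
      + X ^ 4 * (y ^ 2 * fps_const c2) - X ^ 6 * r"
    unfolding Fn t c0_def c1_def c2_def r_def
    by (simp add: power_mult_distrib power_mult[symmetric] algebra_simps)
  have xy: "xpow 1 * y = 1" unfolding y_def by (rule xpow_inverse)
  have "xpow 1 * fps_nth F n = xpow 1 * fps_const c0 - X ^ 2 * ((xpow 1 * y) * fps_const c1)
      + X ^ 4 * ((xpow 1 * y) * (y * fps_const c2)) - X ^ 6 * (xpow 1 * r)"
    unfolding Fn' by (simp add: algebra_simps power2_eq_square)
  then have xF: "xpow 1 * fps_nth F n = (1 + X) * fps_const c0 - X ^ 2 * fps_const c1
      + X ^ 4 * (y * fps_const c2) - X ^ 6 * (xpow 1 * r)"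
    unfolding xy by (simp add: xpow_1 X_def)
  show "fps_nth (fps_nth F n) 1 = 0" "fps_nth (fps_nth F n) 2 = - fps_nth F1 n"
    unfolding Fn' X_def fps_add_nth fps_sub_nth fps_X_power_mult_nth
    by (simp_all add: y0 c1_def)
  show "fps_nth (xpow 1 * fps_nth F n) 3 = 0" "fps_nth (xpow 1 * fps_nth F n) 4 = fps_nth F2 n"
    unfolding xF X_def fps_add_nth fps_sub_nth fps_X_power_mult_nth
    by (simp_all add: y0 c2_def distrib_right)
qed

lemma rank_count_sum:
  "(\<Sum>j = - int n..int n. f j * real (rank_count j n)) = (\<Sum>P\<in>partitions n. f (rank_part P))"
proof -
  have img: "rank_part ` partitions n \<subseteq> {- int n..int n}"
  proof
    fix r assume "r \<in> rank_part ` partitions n"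
    then obtain P where P: "P \<in> partitions n" "r = rank_part P" by blast
    have "largest_part P \<le> n"
      using partition_part_le[OF P(1)] by (intro largest_part_le) auto
    with partition_size_le[OF P(1)] P(2) show "r \<in> {- int n..int n}"
      by (simp add: rank_part_def)
  qed
  have "(\<Sum>P\<in>partitions n. f (rank_part P)) =
      (\<Sum>j = - int n..int n. \<Sum>P | P \<in> partitions n \<and> rank_part P = j. f (rank_part P))"
    by (rule sum.group[symmetric]) (use img in auto)
  also have "\<dots> = (\<Sum>j = - int n..int n. f j * real (rank_count j n))"
    by (intro sum.cong refl) (simp add: rank_count_def mult.commute)
  finally show ?thesis ..
qed

text \<open>
  The factor \<open>x\<close> shifts the rank by one, as the binomial coefficient in \<open>\<eta>\<^sub>4\<close> requires.
\<close>

lemma sym_rank_moment_eq: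
  "sym_rank_moment 4 n = fps_nth (inverse (euler n) * (h2 n - spt2_sum n)) n"
proof -
  have gf: "fps_nth (joint_gf (xpow (- 1)) (xpow 1)) n = (\<Sum>P\<in>partitions n. xpow (rank_part P))"
    unfolding joint_gf_def fps_nth_Abs_fps
    by (intro sum.cong refl) (simp add: xpow_nat xpow_add[symmetric] rank_part_def)
  have "sym_rank_moment 4 n = (\<Sum>P\<in>partitions n. of_int (rank_part P + 1) gchoose 4)"
    unfolding sym_rank_moment_def rank_count_sum by simp
  also have "\<dots> = fps_nth (xpow 1 * fps_nth (joint_gf (xpow (- 1)) (xpow 1)) n) 4"
    unfolding gf sum_distrib_left xpow_add[symmetric] fps_sum_nth
    by (intro sum.cong refl) (simp add: xpow_def add.commute)
  also have "\<dots> = fps_nth (inverse (euler n) * (h2 n - spt2_sum n)) n"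
    by (rule symmetric_expansion_nth(4)[OF rank_expansion[OF xpow_inverse] order.refl])
  finally show ?thesis .
qed

text \<open>
  The basis is adapted to the coefficients computed above: those belonging to the second and the
  fourth summand vanish.
\<close>

lemma fourth_power_gbinomial:
  fixes r :: real
  shows "r ^ 4 = 24 * ((r + 1) gchoose 4) + 12 * ((r + 1) gchoose 3) + 2 * (r gchoose 2) + (r gchoose 1)"
  by (simp add: gbinomial_prod_rev eval_nat_numeral field_simps)

text \<open>
  A finite set of cranks suffices, uniformly in the exceptional case \<open>n = 1\<close> and the combinatorial
  one.
\<close>

lemma crank_count_support:
  obtains M where "finite M" "\<And>m. m \<notin> M \<Longrightarrow> crank_count m n = 0"
    "fps_nth (crank_gf (xpow 1) (xpow (- 1))) n = (\<Sum>m\<in>M. of_int (crank_count m n) * xpow m)"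
proof (cases "n = 1")
  case True
  show ?thesis
  proof (rule that[of "{1, -1, 0}"])
    show "fps_nth (crank_gf (xpow 1) (xpow (- 1))) n =
      (\<Sum>m\<in>{1, -1, 0}. of_int (crank_count m n) * xpow m)"
      using True by (simp add: crank_gf_def crank_count_def)
  qed (use True in \<open>auto simp: crank_count_def\<close>)
next
  case False
  show ?thesis
  proof (rule that[of "crank ` partitions n"])
    have sp: "signed_power (xpow 1) (xpow (- 1)) m = xpow m" for m
      by (simp add: signed_power_def xpow_nat)
    have "fps_nth (crank_gf (xpow 1) (xpow (- 1))) n = (\<Sum>P\<in>partitions n. xpow (crank P))"
      using False by (simp add: crank_gf_def sp)
    also have "\<dots> = (\<Sum>m\<in>crank ` partitions n. \<Sum>P | P \<in> partitions n \<and> crank P = m. xpow (crank P))"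
      by (rule sum.group[symmetric]) auto
    also have "\<dots> = (\<Sum>m\<in>crank ` partitions n. of_int (crank_count m n) * xpow m)"
      using False by (intro sum.cong refl) (simp add: crank_count_def)
    finally show "fps_nth (crank_gf (xpow 1) (xpow (- 1))) n =
      (\<Sum>m\<in>crank ` partitions n. of_int (crank_count m n) * xpow m)" .
    show "crank_count m n = 0" if "m \<notin> crank ` partitions n" for m
    proof -
      have "{P \<in> partitions n. crank P = m} = {}" using that by auto
      then show ?thesis using False by (simp only: crank_count_def) simp
    qed
  qed simp
qed

lemma crank_moment_eq:
  assumes "n \<ge> 1"
  shows "crank_moment 4 n = fps_nth (inverse (euler n) * (24 * h2 n + 2 * e1 n)) n"
proof -
  obtain M where M: "finite M" "\<And>m. m \<notin> M \<Longrightarrow> crank_count m n = 0"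
    and gf: "fps_nth (crank_gf (xpow 1) (xpow (- 1))) n = (\<Sum>m\<in>M. of_int (crank_count m n) * xpow m)"
    using crank_count_support by blast
  let ?C = "fps_nth (crank_gf (xpow 1) (xpow (- 1))) n"
  have c: "of_int k = fps_const (of_int k :: real)" for k by (simp add: fps_of_int)
  have nth: "fps_nth ?C k = (\<Sum>m\<in>M. of_int (crank_count m n) * (of_int m gchoose k))"
    "fps_nth (xpow 1 * ?C) k = (\<Sum>m\<in>M. of_int (crank_count m n) * ((of_int m + 1) gchoose k))" for k
  proof -
    show "fps_nth ?C k = (\<Sum>m\<in>M. of_int (crank_count m n) * (of_int m gchoose k))"
      unfolding gf fps_sum_nth c fps_mult_left_const_nth by (simp add: xpow_def)
    have "xpow 1 * ?C = (\<Sum>m\<in>M. of_int (crank_count m n) * xpow (m + 1))"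
      unfolding gf sum_distrib_left xpow_add by (simp only: ac_simps)
    then show "fps_nth (xpow 1 * ?C) k = (\<Sum>m\<in>M. of_int (crank_count m n) * ((of_int m + 1) gchoose k))"
      unfolding fps_sum_nth c fps_mult_left_const_nth by (simp add: xpow_def fps_sum_nth)
  qed
  note ex = symmetric_expansion_nth[OF crank_expansion[OF xpow_inverse assms] order.refl]
  have "crank_moment 4 n = infsum (\<lambda>m. of_int (m ^ 4 * crank_count m n)) M"
    unfolding crank_moment_def by (rule infsum_cong_neutral) (auto simp: M(2))
  also have "\<dots> = (\<Sum>m\<in>M. of_int (m ^ 4 * crank_count m n))" using M(1) by simp
  also have "\<dots> = (\<Sum>m\<in>M. 24 * (of_int (crank_count m n) * ((of_int m + 1) gchoose 4))
      + 12 * (of_int (crank_count m n) * ((of_int m + 1) gchoose 3))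
      + 2 * (of_int (crank_count m n) * (of_int m gchoose 2))
      + of_int (crank_count m n) * (of_int m gchoose 1))"
    by (intro sum.cong refl) (simp add: fourth_power_gbinomial algebra_simps del: gbinomial_1)
  also have "\<dots> = 24 * fps_nth (xpow 1 * ?C) 4 + 12 * fps_nth (xpow 1 * ?C) 3
      + 2 * fps_nth ?C 2 + fps_nth ?C 1"
    unfolding nth sum_distrib_left sum.distrib ..
  also have "\<dots> = 24 * fps_nth (inverse (euler n) * h2 n) n + 2 * fps_nth (inverse (euler n) * e1 n) n"
    unfolding ex by simp
  also have "\<dots> = fps_nth (inverse (euler n) * (24 * h2 n + 2 * e1 n)) n"
    by (simp add: distrib_left fps_numeral_fps_const mult.left_commute[of _ "fps_const _"])
  finally show ?thesis .
qed

section \<open>The identity\<close>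

text \<open>
  The relation \<open>p\<^sub>1\<^sup>2 + p\<^sub>2 = 2 h\<^sub>2\<close> between power sums and complete homogeneous functions, in the multiples
  that occur in Ramanujan's identity.
\<close>

lemma e1_square: "6 * e1 N ^ 2 + (\<Sum>k=1..N. 6 * dlam k ^ 2) = 12 * h2 N"
proof -
  have "e1 N ^ 2 + (\<Sum>k=1..N. dlam k ^ 2) = 2 * h2 N"
    by (induction N) (simp_all add: e1_def h2_def algebra_simps power2_eq_square)
  then have "6 * (e1 N ^ 2 + (\<Sum>k=1..N. dlam k ^ 2)) = 6 * (2 * h2 N)" by (simp only:)
  then show ?thesis by (simp add: distrib_left sum_distrib_left)
qed

theorem theorem2:
  fixes n :: nat
  assumes "n \<ge> 1"
  shows "SPT_plus n =
           5 / 72 * crank_moment 4 n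
           - 1 / 6 * real n ^ 2 * real (partition_count n)
           + 1 / 36 * real n * real (partition_count n)
           - sym_rank_moment 4 n"
proof -
  \<comment> \<open>every quantity in the claim is a value of this linear functional, so linear arithmetic finishes\<close>
  define c where "c f = fps_nth (inverse (euler n) * f) n" for f
  have lin: "c (f + g) = c f + c g" "c (f - g) = c f - c g" "c (numeral k * f) = numeral k * c f" for f g k
  proof -
    show "c (f + g) = c f + c g" "c (f - g) = c f - c g"
      by (simp_all add: c_def algebra_simps)
    have "inverse (euler n) * (numeral k * f) = fps_const (numeral k) * (inverse (euler n) * f)"
      by (simp only: fps_numeral_fps_const ac_simps)
    then show "c (numeral k * f) = numeral k * c f" by (simp only: c_def fps_mult_left_const_nth)
  qed
  have c_cong: "c f = c g" if "qcong n f g" for f g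
    unfolding c_def by (rule qcongD[OF cong2_mult[OF cong2_refl that] order.refl])
  define D where "D = (\<Sum>k=1..n. of_nat k ^ 2 * dlam k)"
  define Q where "Q = (\<Sum>k=1..n. 6 * dlam k ^ 2)"
  have e: "qcong n (lam_sum n) (e1 n)" by (rule cong2_sym[OF e1_lam_sum])
  have "12 * c (e1 n ^ 2) = 5 * c Q + 6 * c (e1 n) - 6 * c D"
    using c_cong[OF ramanujan_identity[of n]] unfolding D_def[symmetric] Q_def[symmetric] lin .
  moreover have "6 * c (e1 n ^ 2) + c Q = 12 * c (h2 n)"
    unfolding lin[symmetric] Q_def e1_square ..
  moreover have "real n * real (partition_count n) = c (e1 n)"
    using c_cong[OF e] partition_count_moments(1)[of n n] by (simp add: c_def)
  moreover have "real n ^ 2 * real (partition_count n) = c (e1 n ^ 2) + c D"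
  proof -
    have "c (lam_sum n ^ 2 + D) = c (e1 n ^ 2 + D)" by (intro c_cong cong2_intros e)
    moreover have "real n ^ 2 * real (partition_count n) = c (lam_sum n ^ 2 + D)"
      unfolding c_def D_def by (rule partition_count_moments(2)) simp
    ultimately show ?thesis by (simp only: lin)
  qed
  moreover have "SPT_plus n = c (e1 n ^ 2) - c (h2 n) + c (spt2_sum n)"
    unfolding SPT_plus_eq c_def[symmetric] lin ..
  moreover have "crank_moment 4 n = 24 * c (h2 n) + 2 * c (e1 n)"
    unfolding crank_moment_eq[OF assms] c_def[symmetric] lin ..
  moreover have "sym_rank_moment 4 n = c (h2 n) - c (spt2_sum n)"
    unfolding sym_rank_moment_eq c_def[symmetric] lin ..
  ultimately show ?thesis unfolding mult.assoc by linarith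
qed

end
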